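(* Let $1\le m<n$, let $s,t>0$ with $s + t \ge 2m$, and let $\mu,\nu$ be finite nonzero Borel measures on $\mathbb{R}^n$ with compact support such that $I_{s}(\mu) < \infty$ and $I_{t}(\nu) < \infty$. Then $$\gamma_{n,m}\left(\{V\in G(n,m): P_V(\operatorname{spt}\mu)\cap P_V(\operatorname{spt}\nu)\neq \emptyset\}\right)>0.$$ If moreover $s>2m$ and $t>2m$, then $$\gamma_{n,m}\left(\{V\in G(n,m): \operatorname{Int}(P_V(\operatorname{spt}\mu)\cap P_V(\operatorname{spt}\nu))\neq \emptyset\}\right)>0.$$
   Context: For a Borel measure $\mu$ on $\mathbb{R}^n$, $I_s(\mu)=\iint|x-y|^{-s}\,d\mu x\,d\mu y$ is its $s$-energy and $\operatorname{spt}\mu$ its support. $G(n,m)$ is the Grassmannian of $m$-dimensional linear subspaces of $\mathbb{R}^n$, $\gamma_{n,m}$ its orthogonally invariant Borel probability measure, $P_V$ the orthogonal projection onto $V$, and $\operatorname{Int}$ the interior relative to $V$. *)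

theory Defs
  imports "HOL-Analysis.Analysis"
begin

definition grass :: "nat \<Rightarrow> ('a::euclidean_space) set set" where
  "grass m = {V. subspace V \<and> dim V = m}"

definition oproj :: "('a::euclidean_space) set \<Rightarrow> 'a \<Rightarrow> 'a" where
  "oproj V x = (THE p. p \<in> V \<and> (\<forall>v\<in>V. (x - p) \<bullet> v = 0))"

definition gauss_vec :: "('a::euclidean_space) measure" where
  "gauss_vec = density lborel
     (\<lambda>x. ennreal ((2 * pi) powr (- real DIM('a) / 2) * exp (- (norm x)\<^sup>2 / 2)))"

text \<open>The orthogonally invariant probability measure gamma_{n,m} on G(n,m), realised as the
  distribution of the span of m independent standard Gaussian vectors (a.s. m-dimensional).\<close>
definition gamma_grass :: "nat \<Rightarrow> ('a::euclidean_space) set set \<Rightarrow> ennreal" where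
  "gamma_grass m A =
     emeasure (PiM {..<m} (\<lambda>_. (gauss_vec :: 'a measure)))
       {vs \<in> space (PiM {..<m} (\<lambda>_. (gauss_vec :: 'a measure))). span (vs ` {..<m}) \<in> A}"

definition spt :: "('a::metric_space) measure \<Rightarrow> 'a set" where
  "spt \<mu> = {x. \<forall>e>0. emeasure \<mu> (ball x e) > 0}"

definition energy :: "real \<Rightarrow> ('a::real_normed_vector) measure \<Rightarrow> ennreal" where
  "energy s \<mu> = (\<integral>\<^sup>+ x. (\<integral>\<^sup>+ y. (if x = y then \<infinity> else ennreal (norm (x - y) powr (- s))) \<partial>\<mu>) \<partial>\<mu>)"

end

theory Submission
  imports Defs "HOL-Probability.Characteristic_Functions"
begin

text \<open>
  Let \<open>V\<close> be spanned by independent Gaussian vectors \<open>v\<^sub>1, \<dots>, v\<^sub>m\<close> and replace \<open>P\<^sub>V x\<close> by the vector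
  of inner products \<open>v\<^sub>i \<bullet> x\<close>, which has the same fibres. Let \<open>\<lambda>\<close> be the distribution of \<open>x - y\<close>
  under \<open>\<mu> \<otimes> \<nu>\<close>, and let \<open>f\<^sub>\<epsilon>(v)\<close> be the value at \<open>0\<close> of its image under \<open>z \<mapsto> (v\<^sub>i \<bullet> z)\<close>, smoothed by a
  Gaussian of width \<open>\<epsilon>\<close>. If the projections of the two supports are disjoint, \<open>f\<^sub>\<epsilon>(v) \<rightarrow> 0\<close>, while the
  expectation of \<open>f\<^sub>\<epsilon>\<close> is bounded below, so it suffices to dominate \<open>f\<^sub>\<epsilon>\<close> by an integrable function.
  By Fourier inversion \<open>f\<^sub>\<epsilon>(v)\<close> is at most the integral over \<open>u\<close> in \<open>\<real>\<^sup>m\<close> of \<open>|\<mu>^(\<xi>)| |\<nu>^(\<xi>)|\<close> at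
  \<open>\<xi> = \<Sum> u\<^sub>i v\<^sub>i\<close>. Inserting \<open>xy \<le> wx\<^sup>2 + y\<^sup>2/w\<close> with the product weight \<open>w(u) = \<Prod> |u\<^sub>i|\<^sup>b\<close>, the
  expectation of each term is an energy, because the expectation of \<open>cos (\<xi> \<bullet> z)\<close> is
  \<open>exp (- |u|\<^sup>2 |z|\<^sup>2 / 2)\<close> and \<open>\<integral> w(u) exp (- |u|\<^sup>2 r\<^sup>2 / 2) du\<close> is a multiple of \<open>r\<close> to the power
  \<open>- m (1 + b)\<close>.

  If \<open>s, t > 2m\<close>, the same computation with a weight whose reciprocal is integrable shows that
  \<open>\<mu>^\<close> and \<open>\<nu>^\<close> are integrable on almost every \<open>V\<close>. The projections then have continuous densities
  \<open>g\<close> and \<open>h\<close>, and \<open>f\<^sub>\<epsilon>(v) \<rightarrow> \<integral> h d\<mu>\<close>. When this limit is nonzero, \<open>h > 0\<close> on a set of positive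
  \<open>\<mu>\<close>-measure; since \<open>g > 0\<close> holds \<open>\<mu>\<close>-almost everywhere, \<open>g\<close> and \<open>h\<close> are both positive on a common
  open set.
\<close>

section \<open>Gaussian vectors\<close>

lemma borel_measurable_cis [measurable]: "cis \<in> borel_measurable borel"
  by (intro borel_measurable_continuous_onI continuous_intros)

lemma cis_sum: "finite I \<Longrightarrow> cis (\<Sum>i\<in>I. f i) = (\<Prod>i\<in>I. cis (f i))"
  by (induction I rule: finite_induct) (auto simp: cis_mult[symmetric])

lemma integral_cis_std_normal:
  "(CLINT x|lborel. complex_of_real (std_normal_density x) * cis (x * t)) = of_real (exp (- t\<^sup>2 / 2))"
proof -
  have "char std_normal_distribution t = (CLINT x|lborel. std_normal_density x *\<^sub>R iexp (t * x))"
    unfolding char_def by (subst integral_density) auto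
  then show ?thesis
    using char_std_normal_distribution
    by (simp add: cis_conv_exp scaleR_conv_of_real mult.commute fun_eq_iff)
qed

lemma integrable_cis_std_normal:
  "integrable lborel (\<lambda>x. complex_of_real (std_normal_density x) * cis (x * t))"
  by (rule Bochner_Integration.integrable_bound[where f="std_normal_density"])
     (auto simp: norm_mult cis_conv_exp intro!: borel_measurable_continuous_onI continuous_intros)

lemma std_normal_density_prod:
  fixes x :: "'a::euclidean_space"
  shows "(\<Prod>b\<in>Basis. std_normal_density (x \<bullet> b))
    = (2 * pi) powr (- real DIM('a) / 2) * exp (- (norm x)\<^sup>2 / 2)"
proof -
  have 1: "(1 / sqrt (2 * pi)) ^ DIM('a) = (2 * pi) powr (- real DIM('a) / 2)"
  proof -
    have "(1 / sqrt (2 * pi)) ^ DIM('a) = ((2 * pi) powr (- 1 / 2)) powr real DIM('a)"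
      by (subst powr_realpow) (auto simp: powr_minus powr_half_sqrt inverse_eq_divide)
    then show ?thesis by (simp add: powr_powr)
  qed
  have 2: "(\<Sum>b\<in>Basis. - (x \<bullet> b)\<^sup>2 / 2) = - (norm x)\<^sup>2 / 2"
    unfolding power2_norm_eq_inner euclidean_inner[of x x]
    by (simp add: sum_divide_distrib sum_negf power2_eq_square)
  show ?thesis
    unfolding std_normal_density_def prod.distrib
    by (simp only: exp_sum[symmetric, OF finite_Basis] 2 prod_constant 1)
qed

lemma sets_gauss_vec [measurable_cong, simp]: "sets gauss_vec = sets borel"
  by (simp add: gauss_vec_def)

lemma space_gauss_vec [simp]: "space gauss_vec = UNIV"
  by (simp add: gauss_vec_def)

text \<open>The density of \<open>gauss_vec\<close> factorises over \<open>Basis\<close>, so the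
  integral splits into one-dimensional normal characteristic functions, whose exponents add up to
  the squared norm.\<close>

lemma gauss_vec_char:
  fixes z :: "'a::euclidean_space"
  shows "(CLINT v|gauss_vec. cis (v \<bullet> z)) = of_real (exp (- (norm z)\<^sup>2 / 2))"
proof -
  interpret product_sigma_finite "\<lambda>_::'a. lborel :: real measure" by standard
  have *: "gauss_vec = density lborel (\<lambda>x::'a. ennreal (\<Prod>b\<in>Basis. std_normal_density (x \<bullet> b)))"
    by (simp add: gauss_vec_def std_normal_density_prod)
  have "(CLINT v|gauss_vec. cis (v \<bullet> z)) = (CLINT v|lborel. (\<Prod>b\<in>Basis. std_normal_density (v \<bullet> b)) *\<^sub>R cis (v \<bullet> z))"
    unfolding * by (subst integral_density) (auto intro!: prod_nonneg)
  also have "\<dots> = (CLINT f|(\<Pi>\<^sub>M b\<in>(Basis::'a set). lborel). (\<Prod>b\<in>Basis. of_real (std_normal_density (f b)) * cis (f b * (b \<bullet> z))))"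
    by (subst lborel_eq, subst integral_distr)
       (simp_all add: scaleR_conv_of_real prod.distrib cis_sum inner_sum_left_Basis, simp add: inner_sum_left cis_sum)
  also have "\<dots> = (\<Prod>b\<in>Basis. of_real (exp (- (b \<bullet> z)\<^sup>2 / 2)))"
    by (subst product_integral_prod) (auto simp: integral_cis_std_normal integrable_cis_std_normal)
  also have "\<dots> = of_real (exp (- (norm z)\<^sup>2 / 2))"
    unfolding power2_norm_eq_inner euclidean_inner[of z z]
    by (simp add: inner_commute exp_sum[symmetric] of_real_prod[symmetric] sum_divide_distrib sum_negf power2_eq_square del: of_real_prod)
  finally show ?thesis .
qed

lemma prob_space_gauss_vec: "prob_space (gauss_vec :: 'a::euclidean_space measure)"
proof
  have "emeasure (gauss_vec :: 'a measure) (space gauss_vec) = (\<integral>\<^sup>+x. (\<Prod>b\<in>Basis. ennreal (std_normal_density (x \<bullet> b))) \<partial>(lborel :: 'a measure))"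
    by (simp only: gauss_vec_def emeasure_density std_normal_density_prod[symmetric] prod_ennreal)
       (simp add: emeasure_density prod_ennreal)
  also have "\<dots> = (\<Prod>b\<in>(Basis::'a set). (\<integral>\<^sup>+x. ennreal (std_normal_density x) \<partial>lborel))"
    by (rule nn_integral_lborel_prod) auto
  also have "\<dots> = 1"
    using prob_space.emeasure_space_1[OF prob_space_normal_density[of 1 0]] by (simp add: emeasure_density)
  finally show "emeasure (gauss_vec :: 'a measure) (space gauss_vec) = 1" .
qed

text \<open>The substitution \<open>x = a * u\<close> reduces this to the characteristic function of
  the standard normal law.\<close>

lemma gaussian_fourier:
  fixes a w :: real
  assumes "a > 0"
  shows "integrable lborel (\<lambda>u. complex_of_real (exp (- (a * u)\<^sup>2 / 2)) * cis (u * w))" (is ?A)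
    and "(CLINT u|lborel. complex_of_real (exp (- (a * u)\<^sup>2 / 2)) * cis (u * w))
       = of_real (sqrt (2 * pi) / a * exp (- w\<^sup>2 / (2 * a\<^sup>2)))" (is ?B)
proof -
  let ?f = "\<lambda>x. complex_of_real (std_normal_density x) * cis (x * (w / a))"
  have eq: "(\<lambda>u. complex_of_real (exp (- (a * u)\<^sup>2 / 2)) * cis (u * w)) = (\<lambda>u. of_real (sqrt (2 * pi)) * ?f (0 + a * u))"
    using assms by (auto simp: std_normal_density_def fun_eq_iff)
  show ?A unfolding eq
    using assms integrable_cis_std_normal[of "w/a"] by (intro integrable_mult_right lborel_integrable_real_affine) auto
  have "of_real (exp (- (w/a)\<^sup>2 / 2)) = (CLINT x|lborel. ?f x)"
    by (rule integral_cis_std_normal[symmetric])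
  also have "\<dots> = \<bar>a\<bar> *\<^sub>R (CLINT x|lborel. ?f (0 + a * x))"
    by (rule lborel_integral_real_affine) (use assms in auto)
  finally show ?B unfolding eq
    using assms by (subst integral_mult_right_zero) (auto simp: field_simps scaleR_conv_of_real power2_eq_square)
qed

lemma integrable_gaussian: "a > 0 \<Longrightarrow> integrable lborel (\<lambda>u::real. exp (- (a * u)\<^sup>2 / 2))"
  using integrable_norm[OF gaussian_fourier(1)[of a 0]] by (simp add: norm_mult)

section \<open>Fourier transforms and smoothed projections\<close>

text \<open>The image of \<mu> in R^m under x -> (v_i \<bullet> x) has the characteristic function
  \<open>fourier \<mu> (lincomb m v u)\<close> at \<open>u\<close>; so \<open>u\<close> ranges over
  the frequencies in the span of \<open>v\<close>.\<close>

definition lincomb :: "nat \<Rightarrow> (nat \<Rightarrow> 'a::euclidean_space) \<Rightarrow> (nat \<Rightarrow> real) \<Rightarrow> 'a" where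
  "lincomb m v u = (\<Sum>i<m. u i *\<^sub>R v i)"

definition fourier :: "'a::euclidean_space measure \<Rightarrow> 'a \<Rightarrow> complex" where
  "fourier \<mu> \<xi> = (CLINT x|\<mu>. cis (\<xi> \<bullet> x))"

text \<open>This is 2 pi times the normal density with standard deviation \<epsilon>, that is, the
  Fourier transform of exp (-(\<epsilon> u)^2 / 2). Keeping the factor 2 pi frees the inversion
  formula of normalising constants.\<close>

definition gkernel :: "real \<Rightarrow> real \<Rightarrow> real" where
  "gkernel \<epsilon> w = sqrt (2 * pi) / \<epsilon> * exp (- w\<^sup>2 / (2 * \<epsilon>\<^sup>2))"

text \<open>This Gaussian in the frequency has two uses: for small \<epsilon> it is the summation
  factor in Fourier inversion, and for \<epsilon> = \<open>norm z\<close> it is the expectation of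
  \<open>cis (lincomb m v u \<bullet> z)\<close> over Gaussian \<open>v\<close>.\<close>

definition gcutoff :: "nat \<Rightarrow> real \<Rightarrow> (nat \<Rightarrow> real) \<Rightarrow> real" where
  "gcutoff m \<epsilon> u = (\<Prod>i<m. exp (- (\<epsilon> * u i)\<^sup>2 / 2))"

text \<open>Up to the factor (2 pi)^m, this is the density at (v_i \<bullet> p) of the image of
  \<mu> in R^m convolved with a Gaussian of width \<epsilon>. The point p stays in the ambient
  space, so the domain is the same for all \<open>v\<close> and all measures.\<close>

definition smooth_dens :: "nat \<Rightarrow> real \<Rightarrow> 'a::euclidean_space measure \<Rightarrow> (nat \<Rightarrow> 'a) \<Rightarrow> 'a \<Rightarrow> real" where
  "smooth_dens m \<epsilon> \<mu> v p = (LINT x|\<mu>. (\<Prod>i<m. gkernel \<epsilon> (v i \<bullet> (x - p))))"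

abbreviation lebesgue_pow :: "nat \<Rightarrow> (nat \<Rightarrow> real) measure" where
  "lebesgue_pow m \<equiv> PiM {..<m} (\<lambda>_. lborel)"

abbreviation gauss_pow :: "nat \<Rightarrow> (nat \<Rightarrow> 'a::euclidean_space) measure" where
  "gauss_pow m \<equiv> PiM {..<m} (\<lambda>_. gauss_vec)"

lemma sigma_finite_lebesgue_pow: "sigma_finite_measure (lebesgue_pow m)"
proof -
  interpret product_sigma_finite "\<lambda>_::nat. lborel :: real measure" by standard
  show ?thesis by (rule sigma_finite) simp
qed

lemma prob_space_gauss_pow: "prob_space (gauss_pow m)"
  by (intro prob_space_PiM prob_space_gauss_vec)

lemma lincomb_inner: "lincomb m v u \<bullet> z = (\<Sum>i<m. u i * (v i \<bullet> z))"
  by (simp add: lincomb_def inner_sum_left)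

lemma measurable_lincomb [measurable]:
  "(\<lambda>u. lincomb m v u) \<in> borel_measurable (lebesgue_pow m)"
  "(\<lambda>v. lincomb m v u) \<in> borel_measurable (gauss_pow m)"
  "(\<lambda>x. lincomb m (fst x) (snd x)) \<in> borel_measurable (gauss_pow m \<Otimes>\<^sub>M lebesgue_pow m)"
  unfolding lincomb_def by measurable

lemma measurable_gcutoff [measurable]: "gcutoff m \<epsilon> \<in> borel_measurable (lebesgue_pow m)"
  unfolding gcutoff_def by measurable

lemma measurable_gkernel [measurable]: "gkernel \<epsilon> \<in> borel_measurable borel"
  unfolding gkernel_def by measurable

lemma gcutoff_pos: "gcutoff m \<epsilon> u > 0"
  by (auto simp: gcutoff_def intro!: prod_pos)

lemma gkernel_nonneg: "\<epsilon> > 0 \<Longrightarrow> gkernel \<epsilon> w \<ge> 0"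
  by (auto simp: gkernel_def)

lemma gkernel_pos: "\<epsilon> > 0 \<Longrightarrow> gkernel \<epsilon> w > 0"
  by (auto simp: gkernel_def)

lemma integrable_gcutoff: "\<epsilon> > 0 \<Longrightarrow> integrable (lebesgue_pow m) (gcutoff m \<epsilon>)"
proof -
  interpret product_sigma_finite "\<lambda>_::nat. lborel :: real measure" by standard
  show "\<epsilon> > 0 \<Longrightarrow> ?thesis" unfolding gcutoff_def
    by (intro product_integrable_prod integrable_gaussian) auto
qed

lemma gkernel_fourier:
  assumes "\<epsilon> > 0"
  shows "(CLINT u|lebesgue_pow m. of_real (gcutoff m \<epsilon> u) * cis (lincomb m v u \<bullet> z))
    = of_real (\<Prod>i<m. gkernel \<epsilon> (v i \<bullet> z))"
proof -
  interpret product_sigma_finite "\<lambda>_::nat. lborel :: real measure" by standard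
  have "(CLINT u|lebesgue_pow m. of_real (gcutoff m \<epsilon> u) * cis (lincomb m v u \<bullet> z))
     = (CLINT u|lebesgue_pow m. (\<Prod>i<m. of_real (exp (- (\<epsilon> * u i)\<^sup>2 / 2)) * cis (u i * (v i \<bullet> z))))"
    by (simp add: lincomb_inner gcutoff_def cis_sum prod.distrib)
  also have "\<dots> = (\<Prod>i<m. of_real (gkernel \<epsilon> (v i \<bullet> z)))"
    by (subst product_integral_prod)
       (use gaussian_fourier[OF assms] in \<open>auto simp: gkernel_def\<close>)
  finally show ?thesis by simp
qed

text \<open>The v_i \<bullet> z are independent centred normal variables of variance |z|^2. Random
  directions thus see z only through its norm, which is how energies arise.\<close>

lemma gauss_pow_char:
  "(CLINT v|gauss_pow m. cis (lincomb m v u \<bullet> z)) = of_real (gcutoff m (norm z) u)"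
proof -
  interpret G: prob_space "gauss_vec :: 'a measure" by (rule prob_space_gauss_vec)
  interpret product_sigma_finite "\<lambda>_::nat. gauss_vec :: 'a measure" by standard
  have *: "(CLINT x|gauss_vec. cis (u i * (x \<bullet> z))) = of_real (exp (- (norm z * u i)\<^sup>2 / 2))" for i
    using gauss_vec_char[of "u i *\<^sub>R z"] by (simp add: power_mult_distrib mult.commute)
  have "(CLINT v|gauss_pow m. cis (lincomb m v u \<bullet> z))
     = (CLINT v|gauss_pow m. (\<Prod>i<m. cis (u i * (v i \<bullet> z))))"
    by (simp add: lincomb_inner cis_sum)
  also have "\<dots> = (\<Prod>i<m. of_real (exp (- (norm z * u i)\<^sup>2 / 2)))"
    by (subst product_integral_prod) (auto simp: * intro!: G.integrable_const_bound[where B=1])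
  finally show ?thesis by (simp add: gcutoff_def)
qed

text \<open>Supplies the hypothesis of Fubini's theorem below: a bound by an integrable function of
  the second variable suffices because the first factor has finite mass.\<close>

lemma integrable_pair_bound:
  fixes f :: "'a \<times> 'b \<Rightarrow> 'c::{banach, second_countable_topology}"
  assumes "finite_measure M" "sigma_finite_measure N"
    and f: "f \<in> borel_measurable (M \<Otimes>\<^sub>M N)" and g: "integrable N g"
    and le: "\<And>x y. x \<in> space M \<Longrightarrow> y \<in> space N \<Longrightarrow> norm (f (x, y)) \<le> g y"
  shows "integrable (M \<Otimes>\<^sub>M N) f"
proof -
  interpret M: finite_measure M by fact
  interpret N: sigma_finite_measure N by fact
  interpret pair_sigma_finite M N ..
  have [measurable]: "g \<in> borel_measurable N" using g by auto
  have "integrable (M \<Otimes>\<^sub>M N) (\<lambda>x. g (snd x))"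
    by (rule Fubini_integrable) (use g in auto)
  then show ?thesis
    by (rule Bochner_Integration.integrable_bound)
       (use f le in \<open>auto simp: space_pair_measure intro!: AE_I2 order_trans[OF le]\<close>)
qed

lemma measurable_fourier [measurable]:
  fixes \<mu> :: "'a::euclidean_space measure"
  assumes "finite_measure \<mu>" and [measurable_cong]: "sets \<mu> = sets borel"
  shows "fourier \<mu> \<in> borel_measurable borel"
proof -
  interpret finite_measure \<mu> by fact
  show ?thesis unfolding fourier_def by measurable
qed

lemma norm_fourier_le:
  assumes "finite_measure \<mu>"
  shows "cmod (fourier \<mu> \<xi>) \<le> measure \<mu> (space \<mu>)"
proof -
  interpret finite_measure \<mu> by fact
  have "cmod (fourier \<mu> \<xi>) \<le> (LINT x|\<mu>. cmod (cis (\<xi> \<bullet> x)))"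
    unfolding fourier_def by (rule integral_norm_bound)
  then show ?thesis by simp
qed

text \<open>Fourier inversion with a Gaussian cutoff: \<open>gkernel_fourier\<close> writes the
  kernel as an integral over frequencies, and the integrals are exchanged. The cutoff provides the
  integrability that this exchange requires.\<close>

lemma smooth_dens_fourier:
  fixes \<mu> :: "'a::euclidean_space measure"
  assumes \<mu>: "finite_measure \<mu>" and [measurable_cong]: "sets \<mu> = sets borel" and e: "\<epsilon> > 0"
  shows "of_real (smooth_dens m \<epsilon> \<mu> v p) =
    (CLINT u|lebesgue_pow m. of_real (gcutoff m \<epsilon> u) * (fourier \<mu> (lincomb m v u) * cis (- (lincomb m v u \<bullet> p))))"
proof -
  interpret M: finite_measure \<mu> by fact
  interpret N: sigma_finite_measure "lebesgue_pow m" by (rule sigma_finite_lebesgue_pow)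
  interpret pair_sigma_finite \<mu> "lebesgue_pow m" ..
  have [measurable]: "(\<lambda>x. snd x) \<in> measurable (\<mu> \<Otimes>\<^sub>M lebesgue_pow m) (lebesgue_pow m)" by simp
  have "of_real (smooth_dens m \<epsilon> \<mu> v p) = (CLINT x|\<mu>. of_real (\<Prod>i<m. gkernel \<epsilon> (v i \<bullet> (x - p))))"
    unfolding smooth_dens_def by (rule integral_complex_of_real[symmetric])
  also have "\<dots> = (CLINT x|\<mu>. CLINT u|lebesgue_pow m. of_real (gcutoff m \<epsilon> u) * cis (lincomb m v u \<bullet> (x - p)))"
    by (simp only: gkernel_fourier[OF e])
  also have "\<dots> = (CLINT u|lebesgue_pow m. CLINT x|\<mu>. of_real (gcutoff m \<epsilon> u) * cis (lincomb m v u \<bullet> (x - p)))"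
    by (rule Fubini_integral[symmetric], rule integrable_pair_bound[OF \<mu> sigma_finite_lebesgue_pow _ integrable_gcutoff[OF e, of m]])
       (auto simp: norm_mult gcutoff_pos less_imp_le split_beta')
  also have "\<dots> = (CLINT u|lebesgue_pow m. of_real (gcutoff m \<epsilon> u) * (fourier \<mu> (lincomb m v u) * cis (- (lincomb m v u \<bullet> p))))"
  proof (rule Bochner_Integration.integral_cong[OF refl])
    fix u
    have "(CLINT x|\<mu>. cis (lincomb m v u \<bullet> (x - p))) = fourier \<mu> (lincomb m v u) * cis (- (lincomb m v u \<bullet> p))"
      unfolding fourier_def
      by (subst integral_mult_left_zero[symmetric]) (simp add: cis_mult inner_diff_right)
    then show "(CLINT x|\<mu>. of_real (gcutoff m \<epsilon> u) * cis (lincomb m v u \<bullet> (x - p))) = of_real (gcutoff m \<epsilon> u) * (fourier \<mu> (lincomb m v u) * cis (- (lincomb m v u \<bullet> p)))"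
      by simp
  qed
  finally show ?thesis .
qed

lemma expectation_fourier:
  fixes \<mu> :: "'a::euclidean_space measure"
  assumes \<mu>: "finite_measure \<mu>" and [measurable_cong]: "sets \<mu> = sets borel"
  shows "(CLINT v|gauss_pow m. fourier \<mu> (lincomb m v u)) = of_real (LINT z|\<mu>. gcutoff m (norm z) u)"
proof -
  interpret M: finite_measure \<mu> by fact
  interpret N: prob_space "gauss_pow m :: (nat \<Rightarrow> 'a) measure" by (rule prob_space_gauss_pow)
  interpret pair_sigma_finite \<mu> "gauss_pow m :: (nat \<Rightarrow> 'a) measure" ..
  have "(CLINT v|gauss_pow m. fourier \<mu> (lincomb m v u)) = (CLINT z|\<mu>. CLINT v|gauss_pow m. cis (lincomb m v u \<bullet> z))"
    unfolding fourier_def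
    by (rule Fubini_integral, rule integrable_pair_bound[OF \<mu> N.sigma_finite_measure_axioms, of _ "\<lambda>_. 1"])
       (auto simp: split_beta')
  then show ?thesis by (simp add: gauss_pow_char)
qed

lemma smooth_dens_nonneg: "\<epsilon> > 0 \<Longrightarrow> smooth_dens m \<epsilon> \<mu> v p \<ge> 0"
  by (auto simp: smooth_dens_def gkernel_nonneg intro!: Bochner_Integration.integral_nonneg prod_nonneg)

lemma measurable_smooth_dens [measurable]:
  fixes \<mu> :: "'a::euclidean_space measure"
  assumes \<mu>: "finite_measure \<mu>" and [measurable_cong]: "sets \<mu> = sets borel"
  shows "(\<lambda>v. smooth_dens m \<epsilon> \<mu> v p) \<in> borel_measurable (gauss_pow m)"
    and "(\<lambda>p. smooth_dens m \<epsilon> \<mu> v p) \<in> borel_measurable borel"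
proof -
  interpret M: finite_measure \<mu> by fact
  show "(\<lambda>v. smooth_dens m \<epsilon> \<mu> v p) \<in> borel_measurable (gauss_pow m)"
    "(\<lambda>p. smooth_dens m \<epsilon> \<mu> v p) \<in> borel_measurable borel"
    unfolding smooth_dens_def by measurable
qed

lemma integrable_cutoff_fourier:
  fixes \<mu> :: "'a::euclidean_space measure"
  assumes \<mu>: "finite_measure \<mu>" and s [measurable_cong]: "sets \<mu> = sets borel" and e: "\<epsilon> > 0"
  shows "integrable (lebesgue_pow m) (\<lambda>u. complex_of_real (gcutoff m \<epsilon> u) * (fourier \<mu> (lincomb m v u) * cis (- (lincomb m v u \<bullet> p))))"
proof -
  note [measurable] = measurable_fourier[OF \<mu> s]
  show ?thesis
    by (rule Bochner_Integration.integrable_bound[OF integrable_mult_left[OF integrable_gcutoff[OF e, of m], of "measure \<mu> (space \<mu>)"]])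
       (auto simp: norm_mult gcutoff_pos less_imp_le intro!: mult_left_mono norm_fourier_le \<mu> AE_I2)
qed

lemma gcutoff_le_1: "gcutoff m \<epsilon> u \<le> 1"
  by (auto simp: gcutoff_def intro!: prod_le_1)

text \<open>Since the cutoff is at most 1, the bound depends on neither \<epsilon> nor p; this makes
  it a majorant for the limit \<epsilon> -> 0.\<close>

lemma smooth_dens_le:
  fixes \<mu> :: "'a::euclidean_space measure"
  assumes \<mu>: "finite_measure \<mu>" and s: "sets \<mu> = sets borel" and e: "\<epsilon> > 0"
  shows "ennreal (smooth_dens m \<epsilon> \<mu> v p) \<le> (\<integral>\<^sup>+u. ennreal (cmod (fourier \<mu> (lincomb m v u))) \<partial>lebesgue_pow m)"
proof -
  have "ennreal (smooth_dens m \<epsilon> \<mu> v p) = ennreal (cmod (of_real (smooth_dens m \<epsilon> \<mu> v p)))"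
    by (simp add: smooth_dens_nonneg e)
  also have "\<dots> \<le> (\<integral>\<^sup>+u. ennreal (cmod (complex_of_real (gcutoff m \<epsilon> u) * (fourier \<mu> (lincomb m v u) * cis (- (lincomb m v u \<bullet> p))))) \<partial>lebesgue_pow m)"
    unfolding smooth_dens_fourier[OF assms]
    by (rule integral_norm_bound_ennreal[OF integrable_cutoff_fourier[OF assms]])
  also have "\<dots> \<le> (\<integral>\<^sup>+u. ennreal (cmod (fourier \<mu> (lincomb m v u))) \<partial>lebesgue_pow m)"
    by (intro nn_integral_mono ennreal_leI) (auto simp: norm_mult gcutoff_pos less_imp_le gcutoff_le_1 intro!: mult_left_le_one_le)
  finally show ?thesis .
qed

text \<open>Taking the expectation under the integral over \<open>u\<close> replaces the Fourier
  transform by a positive function of \<open>u\<close>, from which a lower bound can be read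
  off.\<close>

lemma expectation_smooth_dens:
  fixes \<mu> :: "'a::euclidean_space measure"
  assumes \<mu>: "finite_measure \<mu>" and s [measurable_cong]: "sets \<mu> = sets borel" and e: "\<epsilon> > 0"
  shows "(LINT v|gauss_pow m. smooth_dens m \<epsilon> \<mu> v 0)
     = (LINT u|lebesgue_pow m. gcutoff m \<epsilon> u * (LINT z|\<mu>. gcutoff m (norm z) u))"
proof -
  interpret M: finite_measure \<mu> by fact
  interpret G: prob_space "gauss_pow m :: (nat \<Rightarrow> 'a) measure" by (rule prob_space_gauss_pow)
  interpret N: sigma_finite_measure "lebesgue_pow m" by (rule sigma_finite_lebesgue_pow)
  interpret pair_sigma_finite "gauss_pow m :: (nat \<Rightarrow> 'a) measure" "lebesgue_pow m" ..
  note [measurable] = measurable_fourier[OF \<mu> s]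
  have [measurable]: "(\<lambda>x. snd x) \<in> measurable (gauss_pow m \<Otimes>\<^sub>M lebesgue_pow m) (lebesgue_pow m)" by simp
  have "complex_of_real (LINT v|gauss_pow m. smooth_dens m \<epsilon> \<mu> v 0)
      = (CLINT v|gauss_pow m. CLINT u|lebesgue_pow m. of_real (gcutoff m \<epsilon> u) * fourier \<mu> (lincomb m v u))"
    using smooth_dens_fourier[OF assms, where p=0] by (simp flip: integral_complex_of_real)
  also have "\<dots> = (CLINT u|lebesgue_pow m. CLINT v|gauss_pow m. of_real (gcutoff m \<epsilon> u) * fourier \<mu> (lincomb m v u))"
    by (rule Fubini_integral[symmetric], rule integrable_pair_bound[OF G.finite_measure_axioms sigma_finite_lebesgue_pow _ integrable_mult_left[OF integrable_gcutoff[OF e, of m], of "measure \<mu> (space \<mu>)"]])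
       (auto simp: norm_mult gcutoff_pos less_imp_le split_beta' intro!: mult_left_mono norm_fourier_le \<mu>)
  also have "\<dots> = (CLINT u|lebesgue_pow m. of_real (gcutoff m \<epsilon> u * (LINT z|\<mu>. gcutoff m (norm z) u)))"
    using expectation_fourier[OF \<mu> s] by simp
  finally show ?thesis unfolding integral_complex_of_real of_real_eq_iff .
qed

lemma measurable_gcutoff_pair [measurable]:
  "(\<lambda>x. gcutoff m (norm (snd x)) (fst x)) \<in> borel_measurable (lebesgue_pow m \<Otimes>\<^sub>M borel)"
  unfolding gcutoff_def by measurable

lemma integral_pos:
  fixes f :: "'a \<Rightarrow> real"
  assumes "integrable M f" "\<And>x. x \<in> space M \<Longrightarrow> f x > 0" "emeasure M (space M) \<noteq> 0"
  shows "(LINT x|M. f x) > 0"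
proof -
  have "(LINT x|M. f x) \<ge> 0" using assms(2) by (intro integral_nonneg_AE AE_I2 less_imp_le)
  moreover have "(LINT x|M. f x) \<noteq> 0"
  proof
    assume "(LINT x|M. f x) = 0"
    then have "AE x in M. f x = 0"
      using assms by (subst (asm) integral_nonneg_eq_0_iff_AE) (auto intro!: AE_I2 less_imp_le)
    then have "AE x in M. False" using AE_space by eventually_elim (use assms(2) in force)
    then show False using assms(3) AE_iff_measurable[of "space M" M "\<lambda>_. False"] by simp
  qed
  ultimately show ?thesis by linarith
qed

lemma gcutoff_antimono: "0 < \<epsilon> \<Longrightarrow> \<epsilon> \<le> \<delta> \<Longrightarrow> gcutoff m \<delta> u \<le> gcutoff m \<epsilon> u"
  unfolding gcutoff_def power_mult_distrib
  by (intro prod_mono) (auto intro!: mult_right_mono power_mono)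

lemma emeasure_lebesgue_pow_nonzero: "emeasure (lebesgue_pow m) (space (lebesgue_pow m)) \<noteq> 0"
proof -
  interpret product_sigma_finite "\<lambda>_::nat. lborel :: real measure" by standard
  show ?thesis by (simp add: space_PiM emeasure_PiM )
qed

text \<open>The integrand in \<open>expectation_smooth_dens\<close> is positive and grows as
  \<epsilon> decreases, so its integral at \<epsilon> = 1 is a lower bound for all smaller
  \<epsilon>.\<close>

lemma expectation_smooth_dens_bounded_below:
  fixes \<mu> :: "'a::euclidean_space measure"
  assumes \<mu>: "finite_measure \<mu>" and s [measurable_cong]: "sets \<mu> = sets borel"
    and nz: "emeasure \<mu> (space \<mu>) \<noteq> 0"
  shows "\<exists>c>0. \<forall>\<epsilon>. 0 < \<epsilon> \<longrightarrow> \<epsilon> \<le> 1 \<longrightarrow> c \<le> (LINT v|gauss_pow m. smooth_dens m \<epsilon> \<mu> v 0)"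
proof -
  interpret M: finite_measure \<mu> by fact
  define h where "h u = (LINT z|\<mu>. gcutoff m (norm z) u)" for u
  have [measurable]: "h \<in> borel_measurable (lebesgue_pow m)" unfolding h_def by measurable
  have [measurable]: "(\<lambda>z. gcutoff m (norm z) u) \<in> borel_measurable \<mu>" for u unfolding gcutoff_def by measurable
  have ig: "integrable \<mu> (\<lambda>z. gcutoff m (norm z) u)" for u
    by (rule M.integrable_const_bound[where B=1]) (auto simp: gcutoff_le_1 gcutoff_pos less_imp_le)
  have hpos: "h u > 0" for u unfolding h_def using ig nz by (intro integral_pos) (auto simp: gcutoff_pos)
  have hle: "h u \<le> measure \<mu> (space \<mu>)" for u
    unfolding h_def using integral_mono[OF ig, of "\<lambda>_. 1"] by (simp add: gcutoff_le_1)
  have int: "integrable (lebesgue_pow m) (\<lambda>u. gcutoff m \<epsilon> u * h u)" if "\<epsilon> > 0" for \<epsilon>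
    by (rule Bochner_Integration.integrable_bound[OF integrable_mult_left[OF integrable_gcutoff[OF that, of m], of "measure \<mu> (space \<mu>)"]])
       (auto simp: abs_mult gcutoff_pos less_imp_le hpos intro!: mult_left_mono hle)
  let ?c = "LINT u|lebesgue_pow m. gcutoff m 1 u * h u"
  have "?c > 0"
    using int[of 1] hpos emeasure_lebesgue_pow_nonzero by (intro integral_pos) (auto simp: gcutoff_pos)
  moreover have "?c \<le> (LINT v|gauss_pow m. smooth_dens m \<epsilon> \<mu> v 0)" if "0 < \<epsilon>" "\<epsilon> \<le> 1" for \<epsilon>
    unfolding expectation_smooth_dens[OF \<mu> s that(1)] h_def[symmetric]
    using int that hpos by (intro integral_mono) (auto simp: less_imp_le intro!: mult_right_mono gcutoff_antimono)
  ultimately show ?thesis by blast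
qed

text \<open>If the smoothed densities tended to 0 almost surely, dominated convergence with the
  majorant \<open>F\<close> would send their expectations to 0, against the uniform lower
  bound.\<close>

lemma smooth_dens_not_null:
  fixes \<mu> :: "'a::euclidean_space measure"
  assumes \<mu>: "finite_measure \<mu>" and s [measurable_cong]: "sets \<mu> = sets borel"
    and nz: "emeasure \<mu> (space \<mu>) \<noteq> 0"
    and fin: "(\<integral>\<^sup>+v. \<integral>\<^sup>+u. ennreal (cmod (fourier \<mu> (lincomb m v u))) \<partial>lebesgue_pow m \<partial>gauss_pow m) < \<infinity>"
  shows "\<not> (AE v in gauss_pow m. (\<lambda>k. smooth_dens m (1 / real (Suc k)) \<mu> v 0) \<longlonglongrightarrow> 0)"
proof
  assume ae: "AE v in gauss_pow m. (\<lambda>k. smooth_dens m (1 / real (Suc k)) \<mu> v 0) \<longlonglongrightarrow> 0"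
  interpret G: prob_space "gauss_pow m :: (nat \<Rightarrow> 'a) measure" by (rule prob_space_gauss_pow)
  interpret N: sigma_finite_measure "lebesgue_pow m" by (rule sigma_finite_lebesgue_pow)
  note [measurable] = measurable_fourier[OF \<mu> s] measurable_smooth_dens[OF \<mu> s]
  define F where "F v = (\<integral>\<^sup>+u. ennreal (cmod (fourier \<mu> (lincomb m v u))) \<partial>lebesgue_pow m)" for v
  have [measurable]: "F \<in> borel_measurable (gauss_pow m)"
    unfolding F_def by measurable
  obtain c where c: "c > 0" "\<And>\<epsilon>. 0 < \<epsilon> \<Longrightarrow> \<epsilon> \<le> 1 \<Longrightarrow> c \<le> (LINT v|gauss_pow m. smooth_dens m \<epsilon> \<mu> v 0)"
    using expectation_smooth_dens_bounded_below[OF \<mu> s nz] by blast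
  have "(\<lambda>k. \<integral>\<^sup>+v. ennreal (smooth_dens m (1 / real (Suc k)) \<mu> v 0) \<partial>gauss_pow m) \<longlonglongrightarrow> (\<integral>\<^sup>+v. 0 \<partial>(gauss_pow m :: (nat \<Rightarrow> 'a) measure))"
  proof (rule nn_integral_dominated_convergence[where w=F])
    show "AE v in gauss_pow m. (\<lambda>k. ennreal (smooth_dens m (1 / real (Suc k)) \<mu> v 0)) \<longlonglongrightarrow> 0"
      using ae by eventually_elim (auto simp: ennreal_0[symmetric] simp del: ennreal_0 intro!: tendsto_ennrealI)
  qed (use fin in \<open>auto simp: F_def intro!: smooth_dens_le \<mu> s\<close>)
  moreover have "ennreal c \<le> (\<integral>\<^sup>+v. ennreal (smooth_dens m (1 / real (Suc k)) \<mu> v 0) \<partial>gauss_pow m)" for k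
  proof -
    let ?e = "1 / real (Suc k)"
    have "ennreal c \<le> ennreal (LINT v|gauss_pow m. smooth_dens m ?e \<mu> v 0)"
      by (intro ennreal_leI c) auto
    also have "\<dots> \<le> ennreal (norm (LINT v|gauss_pow m. smooth_dens m ?e \<mu> v 0))"
      by (intro ennreal_leI) auto
    also have "\<dots> \<le> (\<integral>\<^sup>+v. ennreal (norm (smooth_dens m ?e \<mu> v 0)) \<partial>gauss_pow m)"
    \<comment> \<open>A function that is not integrable has Bochner integral 0, so the bound holds
      in that case too.\<close>
    proof (cases "integrable (gauss_pow m) (\<lambda>v. smooth_dens m ?e \<mu> v 0)")
      case True then show ?thesis by (rule integral_norm_bound_ennreal)
    qed (simp add: not_integrable_integral_eq)
    finally show ?thesis by (simp add: smooth_dens_nonneg del: of_nat_Suc)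
  qed
  ultimately have "ennreal c \<le> 0" by (intro LIMSEQ_le_const[of _ 0]) auto
  then show False using c(1) by simp
qed

section \<open>Differences of independent points and energies\<close>

definition difference_distr :: "'a::euclidean_space measure \<Rightarrow> 'a measure \<Rightarrow> 'a measure" where
  "difference_distr \<mu> \<nu> = distr (\<mu> \<Otimes>\<^sub>M \<nu>) borel (\<lambda>p. fst p - snd p)"

lemma sets_difference_distr [measurable_cong, simp]: "sets (difference_distr \<mu> \<nu>) = sets borel"
  and space_difference_distr [simp]: "space (difference_distr \<mu> \<nu>) = UNIV"
  by (simp_all add: difference_distr_def)

lemma nn_integral_difference_distr:
  assumes "finite_measure \<mu>" "finite_measure \<nu>"
    and [measurable_cong]: "sets \<mu> = sets borel" "sets \<nu> = sets borel"
    and [measurable]: "f \<in> borel_measurable borel"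
  shows "(\<integral>\<^sup>+z. f z \<partial>difference_distr \<mu> \<nu>) = (\<integral>\<^sup>+x. \<integral>\<^sup>+y. f (x - y) \<partial>\<nu> \<partial>\<mu>)"
proof -
  interpret M: finite_measure \<mu> by fact
  interpret N: finite_measure \<nu> by fact
  have "(\<integral>\<^sup>+z. f z \<partial>difference_distr \<mu> \<nu>) = (\<integral>\<^sup>+p. f (fst p - snd p) \<partial>(\<mu> \<Otimes>\<^sub>M \<nu>))"
    unfolding difference_distr_def by (subst nn_integral_distr) auto
  also have "\<dots> = (\<integral>\<^sup>+x. \<integral>\<^sup>+y. f (x - y) \<partial>\<nu> \<partial>\<mu>)"
    by (subst N.nn_integral_fst[symmetric]) auto
  finally show ?thesis .
qed

lemma emeasure_difference_distr_space:
  assumes "finite_measure \<mu>" "finite_measure \<nu>" "sets \<mu> = sets borel" "sets \<nu> = sets borel"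
  shows "emeasure (difference_distr \<mu> \<nu>) (space (difference_distr \<mu> \<nu>)) = emeasure \<mu> (space \<mu>) * emeasure \<nu> (space \<nu>)"
  using nn_integral_difference_distr[OF assms, of "\<lambda>_. 1"] by (simp add: mult.commute)

lemma finite_difference_distr:
  assumes "finite_measure \<mu>" "finite_measure \<nu>" "sets \<mu> = sets borel" "sets \<nu> = sets borel"
  shows "finite_measure (difference_distr \<mu> \<nu>)"
  by (rule finite_measureI)
     (simp only: emeasure_difference_distr_space[OF assms],
      simp add: ennreal_mult_eq_top_iff finite_measure.emeasure_finite assms)

lemma integral_difference_distr:
  fixes f :: "'a::euclidean_space \<Rightarrow> 'b::{banach, second_countable_topology}"
  assumes \<mu>: "finite_measure \<mu>" and \<nu>: "finite_measure \<nu>"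
    and [measurable_cong]: "sets \<mu> = sets borel" "sets \<nu> = sets borel"
    and [measurable]: "f \<in> borel_measurable borel" and B: "\<And>x. norm (f x) \<le> B"
  shows "(LINT z|difference_distr \<mu> \<nu>. f z) = (LINT x|\<mu>. LINT y|\<nu>. f (x - y))"
proof -
  interpret M: finite_measure \<mu> by fact
  interpret N: finite_measure \<nu> by fact
  interpret pair_sigma_finite \<mu> \<nu> ..
  have "(LINT z|difference_distr \<mu> \<nu>. f z) = (LINT p|(\<mu> \<Otimes>\<^sub>M \<nu>). f (fst p - snd p))"
    unfolding difference_distr_def by (subst integral_distr) auto
  also have "\<dots> = (LINT x|\<mu>. LINT y|\<nu>. f (x - y))"
    by (subst integral_fst'[symmetric])
       (auto intro!: integrable_pair_bound[OF \<mu> N.sigma_finite_measure_axioms, where g="\<lambda>_. B"] B)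
  finally show ?thesis .
qed

lemma fourier_difference_distr:
  assumes "finite_measure \<mu>" "finite_measure \<nu>" "sets \<mu> = sets borel" "sets \<nu> = sets borel"
  shows "fourier (difference_distr \<mu> \<nu>) \<xi> = fourier \<mu> \<xi> * cnj (fourier \<nu> \<xi>)"
proof -
  have "fourier (difference_distr \<mu> \<nu>) \<xi> = (CLINT x|\<mu>. CLINT y|\<nu>. cis (\<xi> \<bullet> (x - y)))"
    unfolding fourier_def by (rule integral_difference_distr[OF assms, where B=1]) auto
  also have "\<dots> = (CLINT x|\<mu>. CLINT y|\<nu>. cis (\<xi> \<bullet> x) * cnj (cis (\<xi> \<bullet> y)))"
    by (simp add: cis_mult cis_cnj inner_diff_right)
  also have "\<dots> = fourier \<mu> \<xi> * cnj (fourier \<nu> \<xi>)"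
    by (simp add: fourier_def del: cis_cnj)
  finally show ?thesis .
qed

lemma energy_difference_distr:
  assumes "finite_measure \<mu>" and [measurable_cong]: "sets \<mu> = sets borel"
  shows "energy s \<mu> = (\<integral>\<^sup>+z. (if z = 0 then \<infinity> else ennreal (norm z powr (- s))) \<partial>difference_distr \<mu> \<mu>)"
  unfolding energy_def by (subst nn_integral_difference_distr) (use assms in auto)

text \<open>The function |\<mu>^|^2 is the Fourier transform of the self-difference measure, so its
  expectation is an integral of Gaussians in \<open>u\<close>. Because the weight is a product, the
  integral over \<open>u\<close> factorises into \<open>m\<close> equal integrals on the
  line.\<close>

lemma weighted_fourier_eq:
  fixes \<mu> :: "'a::euclidean_space measure" and w :: "real \<Rightarrow> real"
  assumes \<mu>: "finite_measure \<mu>" and s [measurable_cong]: "sets \<mu> = sets borel"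
    and [measurable]: "w \<in> borel_measurable borel" and wpos: "\<And>u. w u \<ge> 0"
  shows "(\<integral>\<^sup>+v. \<integral>\<^sup>+u. ennreal ((\<Prod>i<m. w (u i)) * (cmod (fourier \<mu> (lincomb m v u)))\<^sup>2) \<partial>lebesgue_pow m \<partial>gauss_pow m)
    = (\<integral>\<^sup>+z. (\<integral>\<^sup>+u. ennreal (w u * exp (- (norm z * u)\<^sup>2 / 2)) \<partial>lborel) ^ m \<partial>difference_distr \<mu> \<mu>)"
proof -
  let ?D = "difference_distr \<mu> \<mu>"
  have D: "finite_measure ?D" using assms by (intro finite_difference_distr)
  interpret M: finite_measure \<mu> by fact
  interpret D: finite_measure ?D by fact
  interpret G: prob_space "gauss_pow m :: (nat \<Rightarrow> 'a) measure" by (rule prob_space_gauss_pow)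
  interpret N: sigma_finite_measure "lebesgue_pow m" by (rule sigma_finite_lebesgue_pow)
  interpret P: product_sigma_finite "\<lambda>_::nat. lborel :: real measure" by standard
  interpret GN: pair_sigma_finite "gauss_pow m :: (nat \<Rightarrow> 'a) measure" "lebesgue_pow m" ..
  interpret ND: pair_sigma_finite "lebesgue_pow m" ?D ..
  note [measurable] = measurable_fourier[OF \<mu> s]
  have [measurable]: "(\<lambda>x. snd x) \<in> measurable (gauss_pow m \<Otimes>\<^sub>M lebesgue_pow m) (lebesgue_pow m)" by simp
  have [measurable]: "(\<lambda>u. \<Prod>i<m. w (u i)) \<in> borel_measurable (lebesgue_pow m)"
    by measurable
  have [measurable]: "(\<lambda>u. ennreal (\<Prod>i<m. w (u i))) \<in> borel_measurable (lebesgue_pow m)"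
    by measurable
  have [measurable]: "(\<lambda>z. gcutoff m (norm z) u) \<in> borel_measurable ?D" for u unfolding gcutoff_def by measurable
  have ig: "integrable ?D (\<lambda>z. gcutoff m (norm z) u)" for u
    by (rule D.integrable_const_bound[where B=1]) (auto simp: gcutoff_le_1 gcutoff_pos less_imp_le)
  \<comment> \<open>\<open>expectation_fourier\<close> for \<open>?D\<close> gives the Bochner
    integral; both integrands are bounded, hence integrable, which permits passing to nonnegative
    integrals.\<close>
  have ev: "(\<integral>\<^sup>+v. ennreal ((cmod (fourier \<mu> (lincomb m v u)))\<^sup>2) \<partial>gauss_pow m) = (\<integral>\<^sup>+z. ennreal (gcutoff m (norm z) u) \<partial>?D)" for u
  proof -
    have "complex_of_real (LINT v|gauss_pow m. (cmod (fourier \<mu> (lincomb m v u)))\<^sup>2) = (CLINT v|gauss_pow m. fourier ?D (lincomb m v u))"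
      by (simp only: fourier_difference_distr[OF \<mu> \<mu> s s] complex_norm_square flip: integral_complex_of_real)
    also have "\<dots> = of_real (LINT z|?D. gcutoff m (norm z) u)"
      by (rule expectation_fourier[OF D]) simp
    finally have eq: "(LINT v|gauss_pow m. (cmod (fourier \<mu> (lincomb m v u)))\<^sup>2) = (LINT z|?D. gcutoff m (norm z) u)"
      unfolding of_real_eq_iff .
    have "integrable (gauss_pow m) (\<lambda>v. (cmod (fourier \<mu> (lincomb m v u)))\<^sup>2)"
      by (rule G.integrable_const_bound[where B="(measure \<mu> (space \<mu>))\<^sup>2"])
         (auto intro!: AE_I2 power_mono norm_fourier_le \<mu>)
    then show ?thesis
      using eq ig by (simp add: nn_integral_eq_integral gcutoff_pos less_imp_le)
  qed
  have "(\<integral>\<^sup>+v. \<integral>\<^sup>+u. ennreal ((\<Prod>i<m. w (u i)) * (cmod (fourier \<mu> (lincomb m v u)))\<^sup>2) \<partial>lebesgue_pow m \<partial>gauss_pow m)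
     = (\<integral>\<^sup>+u. \<integral>\<^sup>+v. ennreal ((\<Prod>i<m. w (u i)) * (cmod (fourier \<mu> (lincomb m v u)))\<^sup>2) \<partial>gauss_pow m \<partial>lebesgue_pow m)"
    by (rule GN.Fubini'[symmetric]) measurable
  also have "\<dots> = (\<integral>\<^sup>+u. \<integral>\<^sup>+z. ennreal (\<Prod>i<m. w (u i)) * ennreal (gcutoff m (norm z) u) \<partial>?D \<partial>lebesgue_pow m)"
    by (simp add: ennreal_mult' prod_nonneg wpos nn_integral_cmult ev)
  also have "\<dots> = (\<integral>\<^sup>+z. \<integral>\<^sup>+u. ennreal (\<Prod>i<m. w (u i)) * ennreal (gcutoff m (norm z) u) \<partial>lebesgue_pow m \<partial>?D)"
    by (rule ND.Fubini'[symmetric]) measurable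
  also have "\<dots> = (\<integral>\<^sup>+z. \<integral>\<^sup>+u. (\<Prod>i<m. ennreal (w (u i) * exp (- (norm z * u i)\<^sup>2 / 2))) \<partial>lebesgue_pow m \<partial>?D)"
    by (simp add: gcutoff_def prod_nonneg wpos prod_ennreal prod.distrib flip: ennreal_mult)
  also have "\<dots> = (\<integral>\<^sup>+z. (\<integral>\<^sup>+u. ennreal (w u * exp (- (norm z * u)\<^sup>2 / 2)) \<partial>lborel) ^ m \<partial>?D)"
    by (subst P.product_nn_integral_prod) auto
  finally show ?thesis .
qed

lemma one_plus_power_le:
  fixes x :: real assumes "x \<ge> 0"
  shows "(1 + x) ^ m \<le> 2 ^ m * (1 + x ^ m)"
proof (cases "x \<le> 1")
  case True
  then have "(1 + x) ^ m \<le> 2 ^ m" using assms by (intro power_mono) auto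
  also have "\<dots> \<le> 2 ^ m * (1 + x ^ m)" using assms by simp
  finally show ?thesis .
next
  case False
  then have "(1 + x) ^ m \<le> (2 * x) ^ m" using assms by (intro power_mono) auto
  also have "\<dots> \<le> 2 ^ m * (1 + x ^ m)" using assms by (simp add: power_mult_distrib)
  finally show ?thesis .
qed

text \<open>The exponent \<open>s / m\<close> is chosen so that the power \<open>m\<close> from
  \<open>weighted_fourier_eq\<close> turns the bound into a multiple of one plus the energy kernel.
  Integration leaves the mass of the difference measure plus the energy.\<close>

lemma weighted_fourier_finite:
  fixes \<mu> :: "'a::euclidean_space measure" and w :: "real \<Rightarrow> real"
  assumes \<mu>: "finite_measure \<mu>" and s [measurable_cong]: "sets \<mu> = sets borel"
    and w [measurable]: "w \<in> borel_measurable borel" and wpos: "\<And>u. w u \<ge> 0"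
    and "m \<ge> 1" and C: "C > 0"
    and le: "\<And>r. r > 0 \<Longrightarrow> (\<integral>\<^sup>+u. ennreal (w u * exp (- (r * u)\<^sup>2 / 2)) \<partial>lborel) \<le> ennreal (C * (1 + r powr (- s / m)))"
    and en: "energy s \<mu> < \<infinity>"
  shows "(\<integral>\<^sup>+v. \<integral>\<^sup>+u. ennreal ((\<Prod>i<m. w (u i)) * (cmod (fourier \<mu> (lincomb m v u)))\<^sup>2) \<partial>lebesgue_pow m \<partial>gauss_pow m) < \<infinity>"
proof -
  let ?D = "difference_distr \<mu> \<mu>"
  let ?E = "\<lambda>z::'a. if z = 0 then \<infinity> else ennreal (norm z powr (- s))"
  have D: "finite_measure ?D" using assms by (intro finite_difference_distr)
  interpret D: finite_measure ?D by fact
  have pt: "(\<integral>\<^sup>+u. ennreal (w u * exp (- (norm z * u)\<^sup>2 / 2)) \<partial>lborel) ^ m \<le> ennreal ((2 * C) ^ m) * (1 + ?E z)" for z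
  \<comment> \<open>At z = 0 the kernel is infinite and C > 0, so the right-hand side is
    infinite.\<close>
  proof (cases "z = 0")
    case False
    have "(\<integral>\<^sup>+u. ennreal (w u * exp (- (norm z * u)\<^sup>2 / 2)) \<partial>lborel) ^ m \<le> (ennreal (C * (1 + norm z powr (- s / m)))) ^ m"
      using False by (intro power_mono le) auto
    also have "\<dots> = ennreal ((C * (1 + norm z powr (- s / m))) ^ m)"
      using C by (intro ennreal_power) auto
    also have "\<dots> \<le> ennreal (C ^ m * (2 ^ m * (1 + (norm z powr (- s / m)) ^ m)))"
      unfolding power_mult_distrib
      using C by (intro ennreal_leI mult_left_mono one_plus_power_le) auto
    also have "(norm z powr (- s / m)) ^ m = norm z powr (- s)"
      using False \<open>m \<ge> 1\<close> by (simp add: powr_powr powr_realpow[symmetric])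
    also have "ennreal (C ^ m * (2 ^ m * (1 + norm z powr (- s)))) = ennreal ((2 * C) ^ m) * (1 + ?E z)"
      using C False by (simp add: power_mult_distrib ennreal_mult ennreal_plus[symmetric] mult_ac del: ennreal_plus flip: ennreal_1)
    finally show ?thesis .
  qed (use C in \<open>simp add: ennreal_mult_top\<close>)
  have "(\<integral>\<^sup>+v. \<integral>\<^sup>+u. ennreal ((\<Prod>i<m. w (u i)) * (cmod (fourier \<mu> (lincomb m v u)))\<^sup>2) \<partial>lebesgue_pow m \<partial>gauss_pow m)
     \<le> (\<integral>\<^sup>+z. ennreal ((2 * C) ^ m) * (1 + ?E z) \<partial>?D)"
    unfolding weighted_fourier_eq[OF \<mu> s w wpos] by (intro nn_integral_mono pt)
  also have "\<dots> = ennreal ((2 * C) ^ m) * (emeasure ?D (space ?D) + energy s \<mu>)"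
    unfolding energy_difference_distr[OF \<mu> s] by (simp add: nn_integral_cmult nn_integral_add)
  also have "\<dots> < \<infinity>"
    using en D.emeasure_finite[of UNIV] by (simp add: ennreal_mult_eq_top_iff ennreal_add_eq_top less_top[symmetric])
  finally show ?thesis .
qed

section \<open>Power weights on the line\<close>

lemma nn_integral_even_le:
  fixes f :: "real \<Rightarrow> ennreal"
  assumes [measurable]: "f \<in> borel_measurable borel"
  shows "(\<integral>\<^sup>+x. f \<bar>x\<bar> \<partial>lborel) \<le> 2 * (\<integral>\<^sup>+x. f x * indicator {0..} x \<partial>lborel)"
proof -
  have "(\<integral>\<^sup>+x. f \<bar>x\<bar> \<partial>lborel) \<le> (\<integral>\<^sup>+x. f x * indicator {0..} x + f (- x) * indicator {0..} (- x) \<partial>lborel)"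
    by (intro nn_integral_mono) (auto simp: indicator_def abs_if)
  also have "\<dots> = (\<integral>\<^sup>+x. f x * indicator {0..} x \<partial>lborel) + (\<integral>\<^sup>+x. f (- x) * indicator {0..} (- x) \<partial>lborel)"
    by (subst nn_integral_add) auto
  also have "(\<integral>\<^sup>+x. f (- x) * indicator {0..} (- x) \<partial>lborel) = (\<integral>\<^sup>+x. f x * indicator {0..} x \<partial>lborel)"
    using nn_integral_real_affine[of "\<lambda>x. f x * indicator {0..} x" "-1" 0] by simp
  finally show ?thesis by (simp add: mult_2)
qed

lemma nn_integral_powr_near_0:
  fixes b :: real assumes "b > -1"
  shows "(\<integral>\<^sup>+x. ennreal (x powr b) * indicator {0..1} x \<partial>lborel) < \<infinity>"
proof -
  have "((\<lambda>x. x powr b) has_integral 1 powr (b + 1) / (b + 1)) {0..1}"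
    by (rule has_integral_powr_from_0) (use assms in auto)
  from nn_integral_has_integral_lebesgue'[OF _ this] show ?thesis
    by (simp add: nn_integral_completion)
qed

lemma nn_integral_powr_near_infinity:
  fixes b :: real assumes "b < -1"
  shows "(\<integral>\<^sup>+x. ennreal (x powr b) * indicator {1..} x \<partial>lborel) < \<infinity>"
proof -
  have "((\<lambda>x. x powr b) has_integral - (1 powr (b + 1)) / (b + 1)) {1..}"
    by (rule has_integral_powr_to_inf) (use assms in auto)
  from nn_integral_has_integral_lebesgue'[OF _ this] show ?thesis
    by (simp add: nn_integral_completion)
qed

text \<open>On [-1, 1] the Gaussian is dropped and b > -1 gives integrability; outside, the power is
  bounded by an integer power \<open>k\<close>, which leaves an absolute moment of the normal
  law.\<close>

lemma nn_integral_abs_powr_gaussian_finite: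
  fixes b :: real assumes "b > -1"
  shows "(\<integral>\<^sup>+u. ennreal (\<bar>u\<bar> powr b * exp (- u\<^sup>2 / 2)) \<partial>lborel) < \<infinity>"
proof -
  define k where "k = nat \<lceil>\<bar>b\<bar>\<rceil>"
  have k: "b \<le> real k" unfolding k_def by linarith
  have "(\<integral>\<^sup>+u. ennreal (\<bar>u\<bar> powr b * exp (- u\<^sup>2 / 2)) \<partial>lborel)
    \<le> (\<integral>\<^sup>+u. ennreal (\<bar>u\<bar> powr b) * indicator {0..1} \<bar>u\<bar> + ennreal (sqrt (2 * pi) * (std_normal_density u * \<bar>u\<bar> ^ k)) \<partial>lborel)"
  proof (rule nn_integral_mono)
    fix u :: real
    show "ennreal (\<bar>u\<bar> powr b * exp (- u\<^sup>2 / 2)) \<le> ennreal (\<bar>u\<bar> powr b) * indicator {0..1} \<bar>u\<bar> + ennreal (sqrt (2 * pi) * (std_normal_density u * \<bar>u\<bar> ^ k))"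
    proof (cases "\<bar>u\<bar> \<le> 1")
      case True
      have "\<bar>u\<bar> powr b * exp (- u\<^sup>2 / 2) \<le> \<bar>u\<bar> powr b" by (intro mult_left_le) auto
      then have "ennreal (\<bar>u\<bar> powr b * exp (- u\<^sup>2 / 2)) \<le> ennreal (\<bar>u\<bar> powr b) * indicator {0..1} \<bar>u\<bar>"
        using True by (simp add: ennreal_leI)
      then show ?thesis by (meson add_increasing2 order_trans zero_le le_add_same_cancel1 order_refl)
    next
      case False
      have "\<bar>u\<bar> powr b \<le> \<bar>u\<bar> powr real k" using False k by (intro powr_mono) auto
      also have "\<dots> = \<bar>u\<bar> ^ k" using False by (intro powr_realpow) auto
      finally have "\<bar>u\<bar> powr b * exp (- u\<^sup>2 / 2) \<le> sqrt (2 * pi) * (std_normal_density u * \<bar>u\<bar> ^ k)"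
        by (simp add: std_normal_density_def mult_right_mono)
      then show ?thesis using False by (simp add: ennreal_leI)
    qed
  qed
  also have "\<dots> = (\<integral>\<^sup>+u. ennreal (\<bar>u\<bar> powr b) * indicator {0..1} \<bar>u\<bar> \<partial>lborel) + (\<integral>\<^sup>+u. ennreal (sqrt (2 * pi) * (std_normal_density u * \<bar>u\<bar> ^ k)) \<partial>lborel)"
    by (rule nn_integral_add) auto
  also have "\<dots> < \<infinity>"
  proof -
    have "(\<integral>\<^sup>+u. ennreal (\<bar>u\<bar> powr b) * indicator {0..1} \<bar>u\<bar> \<partial>lborel) \<le> 2 * (\<integral>\<^sup>+u. ennreal (u powr b) * indicator {0..1} u * indicator {0..} u \<partial>lborel)"
      by (rule nn_integral_even_le) auto
    also have "\<dots> = 2 * (\<integral>\<^sup>+u. ennreal (u powr b) * indicator {0..1} u \<partial>lborel)"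
      by (intro arg_cong[where f="\<lambda>x. 2 * x"] nn_integral_cong) (auto simp: indicator_def)
    also have "\<dots> < \<infinity>" using nn_integral_powr_near_0[OF assms] by (simp add: ennreal_mult_less_top)
    finally have "(\<integral>\<^sup>+u. ennreal (\<bar>u\<bar> powr b) * indicator {0..1} \<bar>u\<bar> \<partial>lborel) < \<infinity>" .
    moreover have "integrable lborel (\<lambda>u. sqrt (2 * pi) * (std_normal_density u * \<bar>u\<bar> ^ k))"
      by (intro integrable_mult_right integrable_std_normal_moment_abs)
    then have "(\<integral>\<^sup>+u. ennreal (sqrt (2 * pi) * (std_normal_density u * \<bar>u\<bar> ^ k)) \<partial>lborel) < \<infinity>"
      by (subst nn_integral_eq_integral) auto
    ultimately show ?thesis by simp
  qed
  finally show ?thesis .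
qed

text \<open>The value at \<open>0\<close> is set to \<open>1\<close>, and not to \<open>0 powr b = 0\<close>, so that the weight has a reciprocal everywhere.\<close>
definition powr_weight :: "real \<Rightarrow> real \<Rightarrow> real" where
  "powr_weight b u = (if u = 0 then 1 else \<bar>u\<bar> powr b)"

lemma measurable_powr_weight [measurable]: "powr_weight b \<in> borel_measurable borel"
  unfolding powr_weight_def by measurable

lemma powr_weight_pos: "powr_weight b u > 0"
  by (simp add: powr_weight_def)

lemma powr_weight_minus: "powr_weight (- b) u = inverse (powr_weight b u)"
  by (simp add: powr_weight_def powr_minus)

text \<open>Scaling by r gives exactly a multiple of \<open>r powr (- a)\<close>. The weaker form
  with \<open>c\<close> lets the energy exponent exceed that of the weight:
  \<open>r powr (- a)\<close> is at most \<open>r powr (- c)\<close> for r \<le> 1 and at most 1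
  otherwise.\<close>

lemma powr_weight_gaussian_le:
  assumes "a > 0" "a \<le> c"
  shows "\<exists>C>0. \<forall>r>0. (\<integral>\<^sup>+u. ennreal (powr_weight (a - 1) u * exp (- (r * u)\<^sup>2 / 2)) \<partial>lborel) \<le> ennreal (C * (1 + r powr (- c)))"
proof -
  let ?I = "\<integral>\<^sup>+u. ennreal (\<bar>u\<bar> powr (a - 1) * exp (- u\<^sup>2 / 2)) \<partial>lborel"
  have "?I < \<infinity>" using nn_integral_abs_powr_gaussian_finite[of "a - 1"] assms by simp
  then obtain C where C: "?I = ennreal C" "C \<ge> 0" by (cases ?I) auto
  \<comment> \<open>Only C \<ge> 0 is known and a positive constant is wanted, hence
    \<open>C + 1\<close>.\<close>
  have "(\<integral>\<^sup>+u. ennreal (powr_weight (a - 1) u * exp (- (r * u)\<^sup>2 / 2)) \<partial>lborel) \<le> ennreal ((C + 1) * (1 + r powr (- c)))" if r: "r > 0" for r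
  proof -
    have "(\<integral>\<^sup>+u. ennreal (powr_weight (a - 1) u * exp (- (r * u)\<^sup>2 / 2)) \<partial>lborel)
      = (\<integral>\<^sup>+u. ennreal (\<bar>u\<bar> powr (a - 1) * exp (- (r * u)\<^sup>2 / 2)) \<partial>lborel)"
      \<comment> \<open>The two weights differ only at \<open>u = 0\<close>, a null set.\<close>
      using AE_lborel_singleton[of 0] by (intro nn_integral_cong_AE) (auto simp: powr_weight_def elim!: eventually_mono)
    also have "\<dots> = \<bar>1 / r\<bar> * (\<integral>\<^sup>+u. ennreal (\<bar>0 + 1 / r * u\<bar> powr (a - 1) * exp (- (r * (0 + 1 / r * u))\<^sup>2 / 2)) \<partial>lborel)"
      by (rule nn_integral_real_affine) (use r in auto)
    also have "\<dots> = ennreal (1 / r) * (\<integral>\<^sup>+u. ennreal ((1 / r) powr (a - 1)) * ennreal (\<bar>u\<bar> powr (a - 1) * exp (- u\<^sup>2 / 2)) \<partial>lborel)"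
      using r by (intro arg_cong2[where f="(*)"] nn_integral_cong) (auto simp: abs_mult powr_divide ennreal_mult[symmetric])
    also have "\<dots> = ennreal (1 / r * (1 / r) powr (a - 1) * C)"
      using r C(2) by (subst nn_integral_cmult) (simp, simp only: C(1), simp add: ennreal_mult[symmetric])
    also have "1 / r * (1 / r) powr (a - 1) = r powr (- a)"
      using r by (simp add: powr_diff powr_minus powr_divide divide_simps)
    also have "r powr (- a) \<le> 1 + r powr (- c)"
    proof (cases "r \<le> 1")
      case True
      then have "r powr (- a) \<le> r powr (- c)" using r assms by (intro powr_mono') auto
      then show ?thesis by simp
    next
      case False
      then have "r powr (- a) \<le> r powr 0" using r assms by (intro powr_mono) auto
      then show ?thesis using r by (simp add: add_increasing2)
    qed
    then have "ennreal (r powr (- a) * C) \<le> ennreal ((C + 1) * (1 + r powr (- c)))"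
      using C r by (subst mult.commute) (intro ennreal_leI mult_mono, auto)
    finally show ?thesis .
  qed
  then show ?thesis using C(2) by (intro exI[of _ "C + 1"]) auto
qed

text \<open>The added 1 keeps the reciprocal of the weight bounded near 0, while large frequencies
  retain the full power \<open>c - 1\<close>.\<close>

lemma one_plus_powr_weight_gaussian_le:
  assumes "c > 2"
  shows "\<exists>C>0. \<forall>r>0. (\<integral>\<^sup>+u. ennreal ((1 + powr_weight (c - 1) u) * exp (- (r * u)\<^sup>2 / 2)) \<partial>lborel) \<le> ennreal (C * (1 + r powr (- c)))"
proof -
  \<comment> \<open>The constant 1 is the power weight with exponent \<open>1 - 1\<close>, so the
    preceding estimate covers it with a = 1.\<close>
  obtain A where A: "A > 0" "\<And>r. r > 0 \<Longrightarrow> (\<integral>\<^sup>+u. ennreal (powr_weight (1 - 1) u * exp (- (r * u)\<^sup>2 / 2)) \<partial>lborel) \<le> ennreal (A * (1 + r powr (- c)))"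
    using powr_weight_gaussian_le[of 1 c] assms by auto
  obtain B where B: "B > 0" "\<And>r. r > 0 \<Longrightarrow> (\<integral>\<^sup>+u. ennreal (powr_weight (c - 1) u * exp (- (r * u)\<^sup>2 / 2)) \<partial>lborel) \<le> ennreal (B * (1 + r powr (- c)))"
    using powr_weight_gaussian_le[of c c] assms by auto
  have "(\<integral>\<^sup>+u. ennreal ((1 + powr_weight (c - 1) u) * exp (- (r * u)\<^sup>2 / 2)) \<partial>lborel) \<le> ennreal ((A + B) * (1 + r powr (- c)))" if r: "r > 0" for r
  proof -
    have "(\<integral>\<^sup>+u. ennreal ((1 + powr_weight (c - 1) u) * exp (- (r * u)\<^sup>2 / 2)) \<partial>lborel)
      = (\<integral>\<^sup>+u. ennreal (powr_weight (1 - 1) u * exp (- (r * u)\<^sup>2 / 2)) + ennreal (powr_weight (c - 1) u * exp (- (r * u)\<^sup>2 / 2)) \<partial>lborel)"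
      by (intro nn_integral_cong) (auto simp: powr_weight_def distrib_right)
    also have "\<dots> = (\<integral>\<^sup>+u. ennreal (powr_weight (1 - 1) u * exp (- (r * u)\<^sup>2 / 2)) \<partial>lborel) + (\<integral>\<^sup>+u. ennreal (powr_weight (c - 1) u * exp (- (r * u)\<^sup>2 / 2)) \<partial>lborel)"
      by (rule nn_integral_add) auto
    also have "\<dots> \<le> ennreal (A * (1 + r powr (- c))) + ennreal (B * (1 + r powr (- c)))"
      using A B r by (intro add_mono) auto
    also have "\<dots> = ennreal ((A + B) * (1 + r powr (- c)))"
      using A(1) B(1) by (subst ennreal_plus[symmetric]) (auto simp: distrib_right)
    finally show ?thesis .
  qed
  then show ?thesis using A(1) B(1) by (intro exI[of _ "A + B"]) auto
qed

text \<open>The reciprocal is at most 1 on [-1, 1] and at most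
  \<open>\<bar>u\<bar> powr (1 - c)\<close> outside, which is integrable at infinity when c > 2.
  With c = s / m this is the condition s > 2 m.\<close>

lemma nn_integral_inverse_one_plus_powr_weight:
  assumes "c > 2"
  shows "(\<integral>\<^sup>+u. ennreal (inverse (1 + powr_weight (c - 1) u)) \<partial>lborel) < \<infinity>"
proof -
  let ?f = "\<lambda>u::real. ennreal (u powr (1 - c)) * indicator {1..} u + indicator {0..1} u"
  have "(\<integral>\<^sup>+u. ennreal (inverse (1 + powr_weight (c - 1) u)) \<partial>lborel) \<le> (\<integral>\<^sup>+u. ?f \<bar>u\<bar> \<partial>lborel)"
  proof (rule nn_integral_mono)
    fix u :: real
    show "ennreal (inverse (1 + powr_weight (c - 1) u)) \<le> ?f \<bar>u\<bar>"
    proof (cases "\<bar>u\<bar> \<le> 1")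
      case True
      have "ennreal (inverse (1 + powr_weight (c - 1) u)) \<le> 1"
        using powr_weight_pos[of "c - 1" u] by (simp add: inverse_le_1_iff)
      then show ?thesis using True by (auto simp: add_increasing)
    next
      case False
      have "inverse (1 + powr_weight (c - 1) u) \<le> inverse (powr_weight (c - 1) u)"
        using powr_weight_pos[of "c - 1" u] by (intro le_imp_inverse_le) auto
      also have "\<dots> = \<bar>u\<bar> powr (1 - c)"
        using False by (simp add: powr_weight_def powr_minus[symmetric])
      finally show ?thesis using False by (simp add: ennreal_leI)
    qed
  qed
  also have "\<dots> \<le> 2 * (\<integral>\<^sup>+u. ?f u * indicator {0..} u \<partial>lborel)"
    by (rule nn_integral_even_le) auto
  also have "(\<integral>\<^sup>+u. ?f u * indicator {0..} u \<partial>lborel) \<le> (\<integral>\<^sup>+u. ?f u \<partial>lborel)"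
    by (intro nn_integral_mono) (auto simp: indicator_def)
  also have "(\<integral>\<^sup>+u. ?f u \<partial>lborel) = (\<integral>\<^sup>+u. ennreal (u powr (1 - c)) * indicator {1..} u \<partial>lborel) + emeasure lborel {0..1::real}"
    by (subst nn_integral_add) auto
  also have "2 * \<dots> < \<infinity>"
    using nn_integral_powr_near_infinity[of "1 - c"] assms by (simp add: ennreal_mult_less_top)
  finally show ?thesis by (simp add: mult_left_mono)
qed

section \<open>Integrability of Fourier transforms along Gaussian spans\<close>

lemma nn_integral_fourier_difference_finite:
  fixes \<mu> \<nu> :: "'a::euclidean_space measure"
  assumes \<mu>: "finite_measure \<mu>" and \<nu>: "finite_measure \<nu>"
    and s\<mu> [measurable_cong]: "sets \<mu> = sets borel" and s\<nu> [measurable_cong]: "sets \<nu> = sets borel"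
    and m: "m \<ge> 1" and st: "s > 0" "t > 0" "s + t \<ge> 2 * real m"
    and en: "energy s \<mu> < \<infinity>" "energy t \<nu> < \<infinity>"
  shows "(\<integral>\<^sup>+v. \<integral>\<^sup>+u. ennreal (cmod (fourier (difference_distr \<mu> \<nu>) (lincomb m v u))) \<partial>lebesgue_pow m \<partial>gauss_pow m) < \<infinity>"
proof -
  interpret N: sigma_finite_measure "lebesgue_pow m" by (rule sigma_finite_lebesgue_pow)
  note [measurable] = measurable_fourier[OF \<mu> s\<mu>] measurable_fourier[OF \<nu> s\<nu>]
  have [measurable]: "(\<lambda>x. snd x) \<in> measurable (gauss_pow m \<Otimes>\<^sub>M lebesgue_pow m) (lebesgue_pow m)" by simp
  have mw [measurable]: "(\<lambda>u. \<Prod>i<m. powr_weight b (u i)) \<in> borel_measurable (lebesgue_pow m)" for b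
    by measurable
  \<comment> \<open>The exponents \<open>a - 1\<close> and \<open>2 - a - 1\<close> are opposite, so
    the two weights are reciprocal. Dividing 2 in the ratio s : t makes \<open>a\<close> and
    \<open>2 - a\<close> positive, and each of a \<le> s / m and 2 - a \<le> t / m amounts to s + t
    \<ge> 2 m.\<close>
  define a where "a = 2 * s / (s + t)"
  have a: "a > 0" "2 - a > 0" using st by (auto simp: a_def field_simps)
  have "s * (m * 2) \<le> s * (s + t)" using st by (intro mult_left_mono) auto
  then have as: "a \<le> s / m" using st m by (auto simp: a_def field_simps)
  have "t * (m * 2) \<le> t * (s + t)" using st by (intro mult_left_mono) auto
  then have at: "2 - a \<le> t / m" using st m by (auto simp: a_def field_simps)
  obtain A where A: "A > 0" "\<And>r. r > 0 \<Longrightarrow> (\<integral>\<^sup>+u. ennreal (powr_weight (a - 1) u * exp (- (r * u)\<^sup>2 / 2)) \<partial>lborel) \<le> ennreal (A * (1 + r powr (- s / m)))"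
    using powr_weight_gaussian_le[OF a(1) as] by auto
  obtain B where B: "B > 0" "\<And>r. r > 0 \<Longrightarrow> (\<integral>\<^sup>+u. ennreal (powr_weight (2 - a - 1) u * exp (- (r * u)\<^sup>2 / 2)) \<partial>lborel) \<le> ennreal (B * (1 + r powr (- t / m)))"
    using powr_weight_gaussian_le[OF a(2) at] by auto
  let ?W = "\<lambda>b u. \<Prod>i<m. powr_weight b (u i)"
  let ?f = "\<lambda>v u. ennreal (?W (a - 1) u * (cmod (fourier \<mu> (lincomb m v u)))\<^sup>2)"
  let ?g = "\<lambda>v u. ennreal (?W (2 - a - 1) u * (cmod (fourier \<nu> (lincomb m v u)))\<^sup>2)"
  have f: "(\<integral>\<^sup>+v. \<integral>\<^sup>+u. ?f v u \<partial>lebesgue_pow m \<partial>gauss_pow m) < \<infinity>"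
    by (rule weighted_fourier_finite[OF \<mu> s\<mu> _ _ m A en(1)]) (auto simp: powr_weight_pos less_imp_le)
  have g: "(\<integral>\<^sup>+v. \<integral>\<^sup>+u. ?g v u \<partial>lebesgue_pow m \<partial>gauss_pow m) < \<infinity>"
    by (rule weighted_fourier_finite[OF \<nu> s\<nu> _ _ m B en(2)]) (auto simp: powr_weight_pos less_imp_le)
  have Wpos: "?W b u > 0" for b u by (intro prod_pos) (auto simp: powr_weight_pos)
  have Winv: "?W (2 - a - 1) u = inverse (?W (a - 1) u)" for u
    using powr_weight_minus[of "a - 1"] by (simp add: prod_inversef[symmetric] del: powr_weight_minus)
  have le: "ennreal (cmod (fourier (difference_distr \<mu> \<nu>) \<xi>)) \<le> ennreal (?W (a - 1) u * (cmod (fourier \<mu> \<xi>))\<^sup>2) + ennreal (?W (2 - a - 1) u * (cmod (fourier \<nu> \<xi>))\<^sup>2)" for \<xi> u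
  proof -
    have *: "x * y \<le> w * x\<^sup>2 + inverse w * y\<^sup>2" if "w > 0" "x \<ge> 0" "y \<ge> 0" for w x y :: real
    proof -
      have "0 \<le> (w * x - y)\<^sup>2" by simp
      also have "\<dots> = w * (w * x\<^sup>2 + inverse w * y\<^sup>2 - 2 * (x * y))"
        using that(1) by (simp add: field_simps power2_eq_square)
      finally have "2 * (x * y) \<le> w * x\<^sup>2 + inverse w * y\<^sup>2" using that(1) by (simp add: zero_le_mult_iff)
      moreover have "x * y \<ge> 0" using that by simp
      ultimately show ?thesis by linarith
    qed
    show ?thesis
      unfolding Winv
      using *[OF Wpos[of "a - 1" u], of "cmod (fourier \<mu> \<xi>)" "cmod (fourier \<nu> \<xi>)"] Wpos[of _ u]
      by (simp add: fourier_difference_distr[OF \<mu> \<nu> s\<mu> s\<nu>] norm_mult ennreal_plus[symmetric] less_imp_le ennreal_leI del: ennreal_plus)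
  qed
  have "(\<integral>\<^sup>+v. \<integral>\<^sup>+u. ennreal (cmod (fourier (difference_distr \<mu> \<nu>) (lincomb m v u))) \<partial>lebesgue_pow m \<partial>gauss_pow m)
     \<le> (\<integral>\<^sup>+v. \<integral>\<^sup>+u. ?f v u + ?g v u \<partial>lebesgue_pow m \<partial>gauss_pow m)"
    by (intro nn_integral_mono le)
  also have "\<dots> = (\<integral>\<^sup>+v. (\<integral>\<^sup>+u. ?f v u \<partial>lebesgue_pow m) + (\<integral>\<^sup>+u. ?g v u \<partial>lebesgue_pow m) \<partial>gauss_pow m)"
    by (intro nn_integral_cong nn_integral_add) measurable
  also have "\<dots> = (\<integral>\<^sup>+v. \<integral>\<^sup>+u. ?f v u \<partial>lebesgue_pow m \<partial>gauss_pow m) + (\<integral>\<^sup>+v. \<integral>\<^sup>+u. ?g v u \<partial>lebesgue_pow m \<partial>gauss_pow m)"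
    by (intro nn_integral_add) measurable
  also have "\<dots> < \<infinity>" using f g by simp
  finally show ?thesis .
qed

text \<open>The inequality x \<le> w x^2 + 1 / w is applied with a product weight: the first term
  has finite expectation by the energy, and the second does not depend on \<open>v\<close> and
  integrates to a power of a finite integral on the line.\<close>

lemma nn_integral_fourier_finite:
  fixes \<mu> :: "'a::euclidean_space measure"
  assumes \<mu>: "finite_measure \<mu>" and s\<mu> [measurable_cong]: "sets \<mu> = sets borel"
    and m: "m \<ge> 1" and s: "s > 2 * real m" and en: "energy s \<mu> < \<infinity>"
  shows "(\<integral>\<^sup>+v. \<integral>\<^sup>+u. ennreal (cmod (fourier \<mu> (lincomb m v u))) \<partial>lebesgue_pow m \<partial>gauss_pow m) < \<infinity>"
proof -
  interpret N: sigma_finite_measure "lebesgue_pow m" by (rule sigma_finite_lebesgue_pow)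
  interpret P: product_sigma_finite "\<lambda>_::nat. lborel :: real measure" by standard
  interpret G: prob_space "gauss_pow m :: (nat \<Rightarrow> 'a) measure" by (rule prob_space_gauss_pow)
  note [measurable] = measurable_fourier[OF \<mu> s\<mu>]
  have [measurable]: "(\<lambda>x. snd x) \<in> measurable (gauss_pow m \<Otimes>\<^sub>M lebesgue_pow m) (lebesgue_pow m)" by simp
  define w where "w u = 1 + powr_weight (s / m - 1) u" for u
  have [measurable]: "w \<in> borel_measurable borel" unfolding w_def by measurable
  have wpos: "w u > 0" for u using powr_weight_pos[of "s / m - 1" u] by (simp add: w_def)
  have sm: "s / m > 2" using s m by (simp add: field_simps)
  obtain A where A: "A > 0" "\<And>r. r > 0 \<Longrightarrow> (\<integral>\<^sup>+u. ennreal (w u * exp (- (r * u)\<^sup>2 / 2)) \<partial>lborel) \<le> ennreal (A * (1 + r powr (- s / m)))"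
    using one_plus_powr_weight_gaussian_le[OF sm] by (auto simp: w_def)
  let ?W = "\<lambda>u. \<Prod>i<m. w (u i)"
  have Wpos: "?W u > 0" for u by (intro prod_pos) (auto simp: wpos)
  have [measurable]: "?W \<in> borel_measurable (lebesgue_pow m)" by measurable
  have f: "(\<integral>\<^sup>+v. \<integral>\<^sup>+u. ennreal (?W u * (cmod (fourier \<mu> (lincomb m v u)))\<^sup>2) \<partial>lebesgue_pow m \<partial>gauss_pow m) < \<infinity>"
    by (rule weighted_fourier_finite[OF \<mu> s\<mu> _ _ m A en(1)]) (auto simp: wpos less_imp_le)
  have g: "(\<integral>\<^sup>+u. ennreal (inverse (?W u)) \<partial>lebesgue_pow m) < \<infinity>"
  proof -
    have "(\<integral>\<^sup>+u. ennreal (inverse (?W u)) \<partial>lebesgue_pow m) = (\<integral>\<^sup>+u. (\<Prod>i<m. ennreal (inverse (w (u i)))) \<partial>lebesgue_pow m)"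
      by (simp add: prod_ennreal wpos less_imp_le prod_inversef[symmetric])
    also have "\<dots> = (\<integral>\<^sup>+u. ennreal (inverse (w u)) \<partial>lborel) ^ m"
      by (subst P.product_nn_integral_prod) auto
    also have "\<dots> < \<infinity>"
      using nn_integral_inverse_one_plus_powr_weight[OF sm] by (simp add: w_def power_less_top_ennreal)
    finally show ?thesis .
  qed
  have le: "ennreal (cmod (fourier \<mu> \<xi>)) \<le> ennreal (?W u * (cmod (fourier \<mu> \<xi>))\<^sup>2) + ennreal (inverse (?W u))" for \<xi> u
  proof -
    have *: "x \<le> w * x\<^sup>2 + inverse w" if "w > 0" "x \<ge> 0" for w x :: real
    proof -
      have "0 \<le> (w * x - 1)\<^sup>2" by simp
      also have "\<dots> = w * (w * x\<^sup>2 + inverse w - 2 * x)"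
        using that(1) by (simp add: field_simps power2_eq_square)
      finally have "2 * x \<le> w * x\<^sup>2 + inverse w" using that(1) by (simp add: zero_le_mult_iff)
      then show ?thesis using that by linarith
    qed
    show ?thesis
      using *[OF Wpos[of u], of "cmod (fourier \<mu> \<xi>)"] Wpos[of u]
      by (simp add: ennreal_plus[symmetric] less_imp_le ennreal_leI del: ennreal_plus)
  qed
  have "(\<integral>\<^sup>+v. \<integral>\<^sup>+u. ennreal (cmod (fourier \<mu> (lincomb m v u))) \<partial>lebesgue_pow m \<partial>gauss_pow m)
     \<le> (\<integral>\<^sup>+v. \<integral>\<^sup>+u. ennreal (?W u * (cmod (fourier \<mu> (lincomb m v u)))\<^sup>2) + ennreal (inverse (?W u)) \<partial>lebesgue_pow m \<partial>gauss_pow m)"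
    by (intro nn_integral_mono le)
  also have "\<dots> = (\<integral>\<^sup>+v. (\<integral>\<^sup>+u. ennreal (?W u * (cmod (fourier \<mu> (lincomb m v u)))\<^sup>2) \<partial>lebesgue_pow m) + (\<integral>\<^sup>+u. ennreal (inverse (?W u)) \<partial>lebesgue_pow m) \<partial>gauss_pow m)"
    by (intro nn_integral_cong nn_integral_add) measurable
  also have "\<dots> = (\<integral>\<^sup>+v. \<integral>\<^sup>+u. ennreal (?W u * (cmod (fourier \<mu> (lincomb m v u)))\<^sup>2) \<partial>lebesgue_pow m \<partial>gauss_pow m) + (\<integral>\<^sup>+u. ennreal (inverse (?W u)) \<partial>lebesgue_pow m)"
    by (subst nn_integral_add) (auto simp: G.emeasure_space_1)
  also have "\<dots> < \<infinity>" using f g by simp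
  finally show ?thesis .
qed

section \<open>Smoothed densities away from the support\<close>

lemma smooth_dens_tendsto_0:
  fixes \<mu> :: "'a::euclidean_space measure"
  assumes \<mu>: "finite_measure \<mu>" and s\<mu> [measurable_cong]: "sets \<mu> = sets borel"
    and C: "compact C" "AE x in \<mu>. x \<in> C"
    and avoid: "\<And>x. x \<in> C \<Longrightarrow> \<exists>i<m. v i \<bullet> (x - p) \<noteq> 0"
  shows "(\<lambda>k. smooth_dens m (1 / real (Suc k)) \<mu> v p) \<longlonglongrightarrow> 0"
proof -
  interpret finite_measure \<mu> by fact
  \<comment> \<open>The squared distance between the images of x and p in R^m. It is positive on
    \<open>C\<close> by \<open>avoid\<close>, so compactness gives a positive lower bound d.\<close>
  let ?q = "\<lambda>x. \<Sum>i<m. (v i \<bullet> (x - p))\<^sup>2"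
  have qpos: "?q x > 0" if x: "x \<in> C" for x
  proof -
    obtain i where i: "i < m" "v i \<bullet> (x - p) \<noteq> 0" using avoid[OF x] by blast
    then show ?thesis by (intro sum_pos2[of _ i]) auto
  qed
  obtain d where d: "d > 0" "\<And>x. x \<in> C \<Longrightarrow> d \<le> ?q x"
  proof (cases "C = {}")
    case False
    have "continuous_on C ?q" by (intro continuous_intros)
    from continuous_attains_inf[OF C(1) False this]
    obtain x0 where x0: "x0 \<in> C" "\<forall>x\<in>C. ?q x0 \<le> ?q x" ..
    show ?thesis by (rule that[OF qpos[OF x0(1)]]) (use x0(2) in blast)
  qed (use that[of 1] in auto)
  \<comment> \<open>For n \<ge> 1 the decay exponent d n^2 / 2 is weakened to d n / 2, which reduces
    the limit to that of x^m / exp x.\<close>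
  let ?b = "\<lambda>n. (sqrt (2 * pi) * n) ^ m * exp (- (d * n / 2))"
  have ker: "(\<Prod>i<m. gkernel (1 / n) (v i \<bullet> (x - p))) \<le> ?b n" if "x \<in> C" "n \<ge> 1" for x and n :: real
  proof -
    have "(\<Prod>i<m. gkernel (1 / n) (v i \<bullet> (x - p))) = (sqrt (2 * pi) * n) ^ m * exp (\<Sum>i<m. - (v i \<bullet> (x - p))\<^sup>2 * n\<^sup>2 / 2)"
      by (simp add: gkernel_def prod.distrib exp_sum power_mult_distrib power_divide)
    also have "(\<Sum>i<m. - (v i \<bullet> (x - p))\<^sup>2 * n\<^sup>2 / 2) = - (?q x * n\<^sup>2 / 2)"
      by (simp add: sum_distrib_right sum_negf sum_divide_distrib)
    also have "(sqrt (2 * pi) * n) ^ m * exp (- (?q x * n\<^sup>2 / 2)) \<le> ?b n"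
    proof -
      have "d * n \<le> ?q x * n\<^sup>2" using that d(1) d(2)[OF that(1)] self_le_power[of n 2] by (intro mult_mono) auto
      then show ?thesis using that by (intro mult_left_mono) auto
    qed
    finally show ?thesis .
  qed
  have le: "smooth_dens m (1 / real (Suc k)) \<mu> v p \<le> ?b (real (Suc k)) * measure \<mu> (space \<mu>)" for k
  proof -
    have "smooth_dens m (1 / real (Suc k)) \<mu> v p \<le> (LINT x|\<mu>. ?b (real (Suc k)))"
      unfolding smooth_dens_def
    proof (rule integral_mono_AE)
      have ae: "AE x in \<mu>. (\<Prod>i<m. gkernel (1 / real (Suc k)) (v i \<bullet> (x - p))) \<le> ?b (real (Suc k))"
        using C(2) by eventually_elim (rule ker, auto)
      then show "AE x in \<mu>. (\<Prod>i<m. gkernel (1 / real (Suc k)) (v i \<bullet> (x - p))) \<le> ?b (real (Suc k))" .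
      show "integrable \<mu> (\<lambda>x. \<Prod>i<m. gkernel (1 / real (Suc k)) (v i \<bullet> (x - p)))"
      proof (rule integrable_const_bound)
        show "AE x in \<mu>. norm (\<Prod>i<m. gkernel (1 / real (Suc k)) (v i \<bullet> (x - p))) \<le> ?b (real (Suc k))"
          using ae by eventually_elim (subst real_norm_def, subst abs_of_nonneg, auto intro!: prod_nonneg gkernel_nonneg simp del: of_nat_Suc)
      qed simp
    qed simp
    then show ?thesis by (simp add: mult_ac)
  qed
  have lim: "(\<lambda>k. ?b (real (Suc k))) \<longlonglongrightarrow> 0"
  proof -
    have "((\<lambda>x::real. x ^ m / exp x) \<longlongrightarrow> 0) at_top" by (rule tendsto_power_div_exp_0)
    moreover have "filterlim (\<lambda>k. d / 2 * real (Suc k)) at_top sequentially"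
      using d(1) by (intro filterlim_tendsto_pos_mult_at_top[OF tendsto_const] filterlim_compose[OF filterlim_real_sequentially filterlim_Suc]) auto
    ultimately have "(\<lambda>k. (d / 2 * real (Suc k)) ^ m / exp (d / 2 * real (Suc k))) \<longlonglongrightarrow> 0"
      by (rule filterlim_compose)
    then have "(\<lambda>k. (sqrt (2 * pi) / (d / 2)) ^ m * ((d / 2 * real (Suc k)) ^ m / exp (d / 2 * real (Suc k)))) \<longlonglongrightarrow> (sqrt (2 * pi) / (d / 2)) ^ m * 0"
      by (intro tendsto_mult tendsto_const)
    moreover have "(sqrt (2 * pi) / (d / 2)) ^ m * ((d / 2 * x) ^ m / exp (d / 2 * x)) = ?b x" for x
    proof -
      have *: "(sqrt (2 * pi) / (d / 2)) ^ m * (d / 2 * x) ^ m = (sqrt (2 * pi) * x) ^ m"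
        using d(1) by (subst power_mult_distrib[symmetric]) simp
      show ?thesis unfolding times_divide_eq_right * by (simp add: exp_minus inverse_eq_divide)
    qed
    ultimately show ?thesis by (simp only: mult_zero_right)
  qed
  show ?thesis
  proof (rule tendsto_sandwich[OF _ _ tendsto_const])
    show "(\<lambda>k. ?b (real (Suc k)) * measure \<mu> (space \<mu>)) \<longlonglongrightarrow> 0"
      using tendsto_mult_right[OF lim, of "measure \<mu> (space \<mu>)"] by simp
  qed (use le in \<open>auto intro!: smooth_dens_nonneg always_eventually simp del: of_nat_Suc\<close>)
qed

text \<open>The complement of the support is covered by null balls, and by Lindelof's theorem
  countably many of them suffice.\<close>

lemma AE_spt:
  fixes \<mu> :: "'a::euclidean_space measure"
  assumes s: "sets \<mu> = sets borel"
  shows "AE x in \<mu>. x \<in> spt \<mu>"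
proof -
  let ?F = "{ball x e | x e. emeasure \<mu> (ball x e) = 0}"
  obtain F' where F': "F' \<subseteq> ?F" "countable F'" "\<Union>F' = \<Union>?F"
    by (rule Lindelof[of ?F]) auto
  have "\<Union>F' \<in> null_sets \<mu>"
  proof -
    have "N \<in> null_sets \<mu>" if "N \<in> F'" for N
      using F'(1) that s by (auto simp: null_sets_def)
    then show ?thesis using null_sets_UN'[OF F'(2), of "\<lambda>x. x" \<mu>] by simp
  qed
  moreover have "- spt \<mu> \<subseteq> \<Union>?F"
  proof
    fix x assume "x \<in> - spt \<mu>"
    then obtain e where "e > 0" "emeasure \<mu> (ball x e) = 0" by (auto simp: spt_def)
    then show "x \<in> \<Union>?F" by (intro UnionI[of "ball x e"]) auto
  qed
  ultimately show ?thesis using F'(3) by (intro AE_I'[of "\<Union>F'"]) auto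
qed

lemma AE_difference_distr:
  fixes \<mu> \<nu> :: "'a::euclidean_space measure"
  assumes \<mu>: "finite_measure \<mu>" and \<nu>: "finite_measure \<nu>"
    and s [measurable_cong]: "sets \<mu> = sets borel" "sets \<nu> = sets borel"
    and K: "AE x in \<mu>. x \<in> K" and L: "AE y in \<nu>. y \<in> L"
    and C [measurable]: "C \<in> sets borel" and KL: "\<And>x y. x \<in> K \<Longrightarrow> y \<in> L \<Longrightarrow> x - y \<in> C"
  shows "AE z in difference_distr \<mu> \<nu>. z \<in> C"
proof -
  have "(\<integral>\<^sup>+z. indicator (- C) z \<partial>difference_distr \<mu> \<nu>) = (\<integral>\<^sup>+x. \<integral>\<^sup>+y. indicator (- C) (x - y) \<partial>\<nu> \<partial>\<mu>)"
    by (rule nn_integral_difference_distr[OF \<mu> \<nu> s]) auto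
  also have "\<dots> = (\<integral>\<^sup>+x. 0 \<partial>\<mu>)"
  proof (rule nn_integral_cong_AE)
    show "AE x in \<mu>. (\<integral>\<^sup>+y. indicator (- C) (x - y) \<partial>\<nu>) = 0"
      using K
    proof eventually_elim
      case (elim x)
      have "(\<integral>\<^sup>+y. indicator (- C) (x - y) \<partial>\<nu>) = (\<integral>\<^sup>+y. 0 \<partial>\<nu>)"
        using L by (intro nn_integral_cong_AE) (auto elim!: eventually_mono simp: KL[OF elim])
      then show ?case by simp
    qed
  qed
  finally have "emeasure (difference_distr \<mu> \<nu>) (- C) = 0" by simp
  then show ?thesis by (intro AE_I[of _ _ "- C"]) auto
qed

section \<open>Orthogonal projections and measurability\<close>

lemma oproj_unique:
  fixes V :: "'a::euclidean_space set"
  assumes V: "subspace V" and p: "p \<in> V" "\<And>v. v \<in> V \<Longrightarrow> (x - p) \<bullet> v = 0"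
  shows "oproj V x = p"
  unfolding oproj_def
proof (rule the_equality)
  fix q assume q: "q \<in> V \<and> (\<forall>v\<in>V. (x - q) \<bullet> v = 0)"
  have "q - p \<in> V" using V p(1) q by (simp add: subspace_diff)
  then have "(x - p) \<bullet> (q - p) = 0" "(x - q) \<bullet> (q - p) = 0" using p(2) q by auto
  then have "(q - p) \<bullet> (q - p) = 0" by (simp add: inner_diff_left)
  then show "q = p" by simp
qed (use p in auto)

lemma
  fixes V :: "'a::euclidean_space set"
  assumes V: "subspace V"
  shows oproj_in: "oproj V x \<in> V"
    and oproj_orthogonal: "v \<in> V \<Longrightarrow> (x - oproj V x) \<bullet> v = 0"
proof -
  obtain y z where yz: "y \<in> span V" "\<And>w. w \<in> span V \<Longrightarrow> orthogonal z w" "x = y + z"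
    using orthogonal_subspace_decomp_exists[of V x] by blast
  have "oproj V x = y"
    by (rule oproj_unique[OF V]) (use yz V in \<open>auto simp: span_eq_iff[THEN iffD2] orthogonal_def\<close>)
  then show "oproj V x \<in> V" "v \<in> V \<Longrightarrow> (x - oproj V x) \<bullet> v = 0"
    using yz V by (auto simp: span_eq_iff[THEN iffD2] orthogonal_def)
qed

lemma orthogonal_to_span_image:
  "(\<forall>w\<in>span (v ` {..<m::nat}). z \<bullet> w = 0) \<longleftrightarrow> (\<forall>i<m. v i \<bullet> z = 0)"
proof safe
  fix w assume z: "\<forall>i<m. v i \<bullet> z = 0" and "w \<in> span (v ` {..<m})"
  have z': "z \<bullet> v i = 0" if "i < m" for i using z that by (simp add: inner_commute)
  show "z \<bullet> w = 0"
    using \<open>w \<in> span (v ` {..<m})\<close> by (induction rule: span_induct_alt) (auto simp: inner_add_right z')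
qed (auto simp: inner_commute span_base)

text \<open>This replaces projections by inner products: the fibres are translates of the orthogonal
  complement, which is cut out by the spanning vectors alone.\<close>

lemma oproj_eq_iff:
  fixes v :: "nat \<Rightarrow> 'a::euclidean_space"
  shows "oproj (span (v ` {..<m})) x = oproj (span (v ` {..<m})) y \<longleftrightarrow> (\<forall>i<m. v i \<bullet> (x - y) = 0)"
proof -
  let ?V = "span (v ` {..<m})"
  have "oproj ?V x = oproj ?V y \<longleftrightarrow> (\<forall>w\<in>?V. (x - y) \<bullet> w = 0)"
  proof safe
    fix w assume eq: "oproj ?V x = oproj ?V y" and w: "w \<in> ?V"
    show "(x - y) \<bullet> w = 0"
      using oproj_orthogonal[OF subspace_span w, of x] oproj_orthogonal[OF subspace_span w, of y] eq
      by (simp add: inner_diff_left)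
  next
    assume *: "\<forall>w\<in>?V. (x - y) \<bullet> w = 0"
    show "oproj ?V x = oproj ?V y"
    proof (rule oproj_unique[OF subspace_span oproj_in[OF subspace_span]])
      fix w assume w: "w \<in> ?V"
      show "(x - oproj ?V y) \<bullet> w = 0"
        using oproj_orthogonal[OF subspace_span w, of y] * w by (simp add: inner_diff_left)
    qed
  qed
  then show ?thesis unfolding orthogonal_to_span_image .
qed

lemma norm_oproj_diff_le:
  fixes V :: "'a::euclidean_space set"
  assumes V: "subspace V"
  shows "norm (oproj V x - oproj V y) \<le> norm (x - y)"
proof -
  let ?d = "oproj V x - oproj V y"
  have d: "?d \<in> V" using V by (simp add: oproj_in subspace_diff)
  have "(x - y - ?d) \<bullet> ?d = 0"
    using oproj_orthogonal[OF V d, of x] oproj_orthogonal[OF V d, of y] by (simp add: inner_diff_left)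
  then have "?d \<bullet> ?d = (x - y) \<bullet> ?d" by (simp add: inner_diff_left)
  also have "\<dots> \<le> norm (x - y) * norm ?d" by (rule norm_cauchy_schwarz)
  finally have "norm ?d * norm ?d \<le> norm (x - y) * norm ?d" by (simp add: dot_square_norm power2_eq_square)
  then show ?thesis by (cases "norm ?d = 0") auto
qed

lemma continuous_on_oproj: "subspace V \<Longrightarrow> continuous_on A (oproj V)"
  unfolding continuous_on_iff dist_norm
  by (blast intro: order_le_less_trans[OF norm_oproj_diff_le])

text \<open>The projection is continuous and fixes V, and its image of a ball about q contains the
  ball in V of the same radius about the projection of q. Interiors relative to a varying V thereby
  become interiors in one fixed space.\<close>

lemma interior_of_subspace_iff:
  fixes V :: "'a::euclidean_space set"
  assumes V: "subspace V" and "S \<subseteq> V"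
  shows "(top_of_set V) interior_of S \<noteq> {} \<longleftrightarrow> interior (oproj V -` S) \<noteq> {}"
proof
  assume "(top_of_set V) interior_of S \<noteq> {}"
  then obtain x T where T: "openin (top_of_set V) T" "x \<in> T" "T \<subseteq> S" by (auto simp: interior_of_def)
  then obtain U where U: "open U" "T = V \<inter> U" by (auto simp: openin_open)
  have "open (oproj V -` U)" using U(1) continuous_on_oproj[OF V, of UNIV]
    by (simp add: continuous_on_open_vimage)
  moreover have "oproj V -` U \<subseteq> oproj V -` S" using U T oproj_in[OF V] by blast
  moreover have "oproj V x = x" using T U V by (intro oproj_unique) auto
  then have "x \<in> oproj V -` U" using T U by auto
  ultimately show "interior (oproj V -` S) \<noteq> {}" by (metis interiorI empty_iff)
next
  assume "interior (oproj V -` S) \<noteq> {}"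
  then obtain q r where r: "r > 0" "ball q r \<subseteq> oproj V -` S"
    by (metis all_not_in_conv mem_interior)
  have "V \<inter> ball (oproj V q) r \<subseteq> S"
  proof
    fix w assume w: "w \<in> V \<inter> ball (oproj V q) r"
    \<comment> \<open>The point q is moved parallel to V until its projection is w; the displacement
      \<open>w - oproj V q\<close> has norm below r.\<close>
    let ?p = "q + w - oproj V q"
    have "oproj V ?p = w"
      using w oproj_orthogonal[OF V, of _ q] by (intro oproj_unique[OF V]) (auto simp: inner_diff_left inner_add_left)
    moreover have "?p \<in> ball q r" using w by (simp add: dist_norm norm_minus_commute)
    ultimately show "w \<in> S" using r(2) by auto
  qed
  moreover have "openin (top_of_set V) (V \<inter> ball (oproj V q) r)" by (simp add: openin_open_Int)
  moreover have "oproj V q \<in> V \<inter> ball (oproj V q) r" using r oproj_in[OF V] by simp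
  ultimately show "(top_of_set V) interior_of S \<noteq> {}"
    unfolding interior_of_def by blast
qed

text \<open>This is the preimage of \<open>P\<^sub>V K\<close> under \<open>P\<^sub>V\<close>, where \<open>V\<close> is the span of \<open>v\<close>.\<close>
definition cylinder :: "nat \<Rightarrow> (nat \<Rightarrow> 'a::euclidean_space) \<Rightarrow> 'a set \<Rightarrow> 'a set" where
  "cylinder m v K = {p. \<exists>x\<in>K. \<forall>i<m. v i \<bullet> (x - p) = 0}"

lemma oproj_mem_iff: "oproj (span (v ` {..<m})) p \<in> oproj (span (v ` {..<m})) ` K \<longleftrightarrow> p \<in> cylinder m v K"
proof -
  have "oproj (span (v ` {..<m})) p \<in> oproj (span (v ` {..<m})) ` K \<longleftrightarrow> (\<exists>x\<in>K. oproj (span (v ` {..<m})) x = oproj (span (v ` {..<m})) p)"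
    by (metis imageE imageI)
  then show ?thesis unfolding oproj_eq_iff cylinder_def by simp
qed

text \<open>The cylinder is the sum of the compact set K and a closed subspace.\<close>

lemma closed_cylinder:
  assumes "compact K" shows "closed (cylinder m v K)"
proof -
  let ?W = "{y. \<forall>i<m. v i \<bullet> y = 0}"
  have "?W = (\<Inter>i\<in>{..<m}. {y. v i \<bullet> y = 0})" by auto
  then have "closed ?W" by (auto intro!: closed_INT closed_hyperplane)
  then have "closed (\<Union>x\<in>K. \<Union>y\<in>?W. {x + y})" by (rule compact_closed_sums[OF assms])
  also have "(\<Union>x\<in>K. \<Union>y\<in>?W. {x + y}) = cylinder m v K"
  proof safe
    fix p assume "p \<in> cylinder m v K"
    then obtain x where x: "x \<in> K" "\<forall>i<m. v i \<bullet> (x - p) = 0" by (auto simp: cylinder_def)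
    then have "p - x \<in> ?W" by (simp add: inner_diff_right)
    with x(1) show "p \<in> (\<Union>x\<in>K. \<Union>y\<in>?W. {x + y})" by (auto intro!: bexI[of _ x] exI[of _ "p - x"])
  qed (auto simp: cylinder_def inner_diff_right inner_add_right intro!: bexI)
  finally show ?thesis .
qed

text \<open>A closed set contains an open ball once it contains the points of the ball in a dense
  set. For countable D only countable quantifiers remain, as measurability requires.\<close>

lemma interior_nonempty_iff_dense:
  fixes H D :: "'a::euclidean_space set"
  assumes H: "closed H" and D: "closure D = UNIV"
  shows "interior H \<noteq> {} \<longleftrightarrow> (\<exists>q\<in>D. \<exists>k::nat. \<forall>p\<in>D. dist q p < 1 / real (Suc k) \<longrightarrow> p \<in> H)"
proof
  assume "interior H \<noteq> {}"
  then have "interior H \<inter> closure D \<noteq> {}" using D by auto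
  then have "interior H \<inter> D \<noteq> {}" by (simp add: open_Int_closure_eq_empty)
  then obtain q where q: "q \<in> D" "q \<in> interior H" by auto
  then obtain r where r: "r > 0" "ball q r \<subseteq> H" by (auto simp: mem_interior)
  obtain k where "1 / real (Suc k) < r" using r(1) nat_approx_posE by blast
  then show "\<exists>q\<in>D. \<exists>k::nat. \<forall>p\<in>D. dist q p < 1 / real (Suc k) \<longrightarrow> p \<in> H"
    using q r by (intro bexI[of _ q] exI[of _ k]) (auto simp: subset_iff)
next
  assume "\<exists>q\<in>D. \<exists>k::nat. \<forall>p\<in>D. dist q p < 1 / real (Suc k) \<longrightarrow> p \<in> H"
  then obtain q k where qk: "\<And>p. p \<in> D \<Longrightarrow> dist q p < 1 / real (Suc k) \<Longrightarrow> p \<in> H" by blast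
  let ?B = "ball q (1 / real (Suc k))"
  have "?B \<subseteq> closure (?B \<inter> D)" using open_Int_closure_subset[of ?B D] D by auto
  also have "\<dots> \<subseteq> H" using qk H by (intro closure_minimal) auto
  finally have "q \<in> interior H" by (auto simp: mem_interior intro!: exI[of _ "1 / real (Suc k)"])
  then show "interior H \<noteq> {}" by blast
qed

text \<open>A nonnegative continuous function attains its minimum on a nonempty compact set, so it
  has a zero there iff it takes arbitrarily small values on a countable dense subset.\<close>

lemma pred_exists_zero_compact:
  fixes F :: "'b \<Rightarrow> 'a::euclidean_space \<Rightarrow> real"
  assumes C: "compact C" and cont: "\<And>v. continuous_on UNIV (F v)"
    and meas: "\<And>z. (\<lambda>v. F v z) \<in> borel_measurable M" and nn: "\<And>v z. F v z \<ge> 0"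
  shows "Measurable.pred M (\<lambda>v. \<exists>z\<in>C. F v z = 0)"
proof -
  obtain D where D: "countable D" "D \<subseteq> C" "C \<subseteq> closure D" using separable by blast
  have "(\<exists>z\<in>C. F v z = 0) \<longleftrightarrow> (\<forall>n::nat. \<exists>z\<in>D. F v z < 1 / real (Suc n))" for v
  proof
    assume "\<exists>z\<in>C. F v z = 0"
    then obtain z where z: "z \<in> C" "F v z = 0" by blast
    show "\<forall>n::nat. \<exists>z\<in>D. F v z < 1 / real (Suc n)"
    proof
      fix n :: nat
      have o: "open (F v -` {..< 1 / real (Suc n)})"
        using cont[of v] by (simp add: continuous_on_open_vimage)
      have "z \<in> F v -` {..< 1 / real (Suc n)} \<inter> closure D" using z D by auto
      then have "F v -` {..< 1 / real (Suc n)} \<inter> D \<noteq> {}"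
        using open_Int_closure_eq_empty[OF o, of D] by blast
      then show "\<exists>z\<in>D. F v z < 1 / real (Suc n)" by auto
    qed
  next
    assume *: "\<forall>n::nat. \<exists>z\<in>D. F v z < 1 / real (Suc n)"
    then have "C \<noteq> {}" using D by auto
    from continuous_attains_inf[OF C this continuous_on_subset[OF cont[of v]]]
    obtain z0 where z0: "z0 \<in> C" "\<forall>z\<in>C. F v z0 \<le> F v z" by auto
    have "F v z0 < 1 / real (Suc n)" for n
    proof -
      obtain z where "z \<in> D" "F v z < 1 / real (Suc n)" using * by blast
      then show ?thesis using z0(2) D(2) by (meson le_less_trans subset_iff)
    qed
    then have "F v z0 \<le> 0" by (meson nat_approx_posE not_less order_less_asym)
    then show "\<exists>z\<in>C. F v z = 0" using z0(1) nn[of v z0] by (intro bexI[of _ z0]) auto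
  qed
  then show ?thesis
    using D(1) meas by (simp only:) (intro pred_intros_countable measurable_pred_countable, measurable)
qed

lemma pred_hits_compact:
  fixes C :: "'a::euclidean_space set"
  assumes "compact C"
  shows "Measurable.pred (gauss_pow m) (\<lambda>v. \<exists>z\<in>C. \<forall>i<m. v i \<bullet> z = 0)"
proof -
  have "Measurable.pred (gauss_pow m) (\<lambda>v. \<exists>z\<in>C. (\<Sum>i<m. \<bar>v i \<bullet> z\<bar>) = 0)"
    by (rule pred_exists_zero_compact[OF assms]) (auto intro!: continuous_intros sum_nonneg)
  then show ?thesis by (simp add: sum_nonneg_eq_0_iff Ball_def)
qed

lemma pred_mem_cylinder:
  fixes K :: "'a::euclidean_space set"
  assumes "compact K"
  shows "Measurable.pred (gauss_pow m) (\<lambda>v. p \<in> cylinder m v K)"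
proof -
  have "compact ((\<lambda>x. x - p) ` K)" using assms by (intro compact_continuous_image continuous_intros)
  from pred_hits_compact[OF this] show ?thesis by (simp add: cylinder_def)
qed

text \<open>A vector outside the span has a nonzero component d orthogonal to it, and a multiple of
  d is the witness y. Bounding y by n gives existence over compact balls, to which
  \<open>pred_exists_zero_compact\<close> applies.\<close>

lemma not_mem_span_iff:
  fixes v :: "nat \<Rightarrow> 'a::euclidean_space"
  shows "x \<notin> span (v ` {..<k}) \<longleftrightarrow> (\<exists>n::nat. \<exists>y\<in>cball 0 (real n). (\<forall>j<k. v j \<bullet> y = 0) \<and> x \<bullet> y = 1)"
proof
  let ?V = "span (v ` {..<k})"
  assume x: "x \<notin> ?V"
  define d where "d = x - oproj ?V x"
  have "d \<noteq> 0" using x oproj_in[of ?V x] by (auto simp: d_def)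
  have o: "d \<bullet> w = 0" if "w \<in> ?V" for w
    using oproj_orthogonal[OF subspace_span that] by (simp add: d_def)
  have "x \<bullet> d = d \<bullet> d" using o[OF oproj_in[OF subspace_span, of _ x]] by (simp add: d_def inner_diff_left inner_diff_right inner_commute)
  then have "x \<bullet> (inverse (d \<bullet> d) *\<^sub>R d) = 1" using \<open>d \<noteq> 0\<close> by simp
  moreover have "\<forall>j<k. v j \<bullet> (inverse (d \<bullet> d) *\<^sub>R d) = 0"
  proof safe
    fix j assume "j < k"
    then have "d \<bullet> v j = 0" by (intro o span_base) auto
    then show "v j \<bullet> (inverse (d \<bullet> d) *\<^sub>R d) = 0" by (simp add: inner_commute)
  qed
  moreover obtain n where "norm (inverse (d \<bullet> d) *\<^sub>R d) \<le> real n" using real_arch_simple by blast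
  ultimately show "\<exists>n::nat. \<exists>y\<in>cball 0 (real n). (\<forall>j<k. v j \<bullet> y = 0) \<and> x \<bullet> y = 1"
    by (intro exI[of _ n] bexI[of _ "inverse (d \<bullet> d) *\<^sub>R d"]) auto
next
  assume "\<exists>n::nat. \<exists>y\<in>cball 0 (real n). (\<forall>j<k. v j \<bullet> y = 0) \<and> x \<bullet> y = 1"
  then obtain y where y: "\<forall>j<k. v j \<bullet> y = 0" "x \<bullet> y = 1" by blast
  then have "\<forall>w\<in>span (v ` {..<k}). y \<bullet> w = 0" by (simp only: orthogonal_to_span_image simp_thms)
  then show "x \<notin> span (v ` {..<k})" using y(2) by (auto simp: inner_commute)
qed

lemma pred_not_mem_span:
  assumes "k < m"
  shows "Measurable.pred (gauss_pow m) (\<lambda>v. (v k :: 'a::euclidean_space) \<notin> span (v ` {..<k}))"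
proof -
  have *: "(\<lambda>v. v j \<bullet> y) \<in> borel_measurable (gauss_pow m)" if "j \<le> k" for j and y :: 'a
  proof -
    have "(\<lambda>v. v j) \<in> measurable (gauss_pow m) (gauss_vec :: 'a measure)"
      using that assms by (intro measurable_component_singleton) auto
    then have "(\<lambda>v. v j :: 'a) \<in> borel_measurable (gauss_pow m)"
      using measurable_cong_sets[OF refl sets_gauss_vec] by blast
    then show ?thesis by (intro borel_measurable_inner borel_measurable_const)
  qed
  have "Measurable.pred (gauss_pow m) (\<lambda>v. \<exists>n::nat. \<exists>y\<in>cball 0 (real n). (\<Sum>j<k. \<bar>v j \<bullet> (y::'a)\<bar>) + \<bar>v k \<bullet> y - 1\<bar> = 0)"
    by (intro pred_intros_countable pred_exists_zero_compact compact_cball)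
       (auto intro!: continuous_intros sum_nonneg add_nonneg_nonneg borel_measurable_add borel_measurable_sum
          borel_measurable_abs borel_measurable_diff *)
  moreover have "(\<Sum>j<k. \<bar>v j \<bullet> (y::'a)\<bar>) + \<bar>v k \<bullet> y - 1\<bar> = 0 \<longleftrightarrow> (\<forall>j<k. v j \<bullet> y = 0) \<and> v k \<bullet> y = 1" for v y
    by (subst add_nonneg_eq_0_iff) (auto simp: sum_nonneg_eq_0_iff sum_nonneg)
  ultimately show ?thesis unfolding not_mem_span_iff by (simp only:)
qed

text \<open>The dimension grows by one exactly at the vectors outside the span of their
  predecessors. In this form the event is a finite intersection of events known to be
  measurable.\<close>

lemma dim_image_eq_iff:
  fixes v :: "nat \<Rightarrow> 'a::euclidean_space"
  shows "dim (v ` {..<m}) = m \<longleftrightarrow> (\<forall>k<m. v k \<notin> span (v ` {..<k}))"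
proof (induction m)
  case (Suc m)
  \<comment> \<open>This excludes that the first \<open>m\<close> vectors already reach dimension
    \<open>Suc m\<close>.\<close>
  have "dim (v ` {..<m}) \<le> card (v ` {..<m})" by (rule dim_le_card') simp
  also have "\<dots> \<le> m" using card_image_le[of "{..<m}" v] by simp
  finally have "dim (v ` {..<m}) \<le> m" .
  then show ?case using Suc by (auto simp: lessThan_Suc dim_insert less_Suc_eq)
qed simp

lemma emeasure_gauss_vec_subspace:
  fixes S :: "'a::euclidean_space set"
  assumes "subspace S" "dim S < DIM('a)"
  shows "emeasure gauss_vec S = 0"
proof -
  have "S \<in> null_sets lebesgue" using negligible_lowdim[OF assms(2)] by (simp add: negligible_iff_null_sets)
  moreover have b: "S \<in> sets borel" using closed_subspace[OF assms(1)] by simp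
  ultimately have "S \<in> null_sets lborel" by (auto simp: null_sets_def)
  then show ?thesis
    unfolding gauss_vec_def using b by (subst emeasure_density) (auto intro!: nn_integral_null_set)
qed

text \<open>With the other vectors fixed, v_k lies in the span of its predecessors with probability
  0, since that span has dimension at most k < \<open>DIM('a)\<close>. Fubini's theorem and a finite
  intersection over k conclude.\<close>

lemma AE_dim_gauss_pow:
  assumes m: "m < DIM('a::euclidean_space)"
  shows "AE v in gauss_pow m. dim ((v :: nat \<Rightarrow> 'a) ` {..<m}) = m"
proof -
  interpret G: prob_space "gauss_vec :: 'a measure" by (rule prob_space_gauss_vec)
  interpret P: product_sigma_finite "\<lambda>_::nat. gauss_vec :: 'a measure" by standard
  have "AE v in gauss_pow m. (v k :: 'a) \<notin> span (v ` {..<k})" if k: "k < m" for k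
  proof -
    let ?N = "{v \<in> space (gauss_pow m). (v k :: 'a) \<in> span (v ` {..<k})}"
    let ?I = "{..<m} - {k}"
    have ins: "insert k ?I = {..<m}" using k by auto
    have "?N = space (gauss_pow m) - {v \<in> space (gauss_pow m). v k \<notin> span (v ` {..<k})}" by auto
    also have "\<dots> \<in> sets (gauss_pow m)"
      using pred_not_mem_span[OF k, where 'a='a] by (intro sets.Diff sets.top) (simp only: pred_def)
    finally have N: "?N \<in> sets (gauss_pow m)" .
    have "emeasure (gauss_pow m) ?N = (\<integral>\<^sup>+v. indicator ?N v \<partial>gauss_pow m)" using N by simp
    also have "\<dots> = (\<integral>\<^sup>+v. \<integral>\<^sup>+y. indicator ?N (v(k := y)) \<partial>gauss_vec \<partial>PiM ?I (\<lambda>_. gauss_vec))"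
      using P.product_nn_integral_insert[of ?I k "indicator ?N", unfolded ins] N by simp
    also have "\<dots> \<le> (\<integral>\<^sup>+v. \<integral>\<^sup>+y. indicator (span (v ` {..<k})) y \<partial>gauss_vec \<partial>PiM ?I (\<lambda>_. gauss_vec :: 'a measure))"
    proof (intro nn_integral_mono)
      fix v :: "nat \<Rightarrow> 'a" and y :: 'a
      \<comment> \<open>Only indices below k enter the span, so replacing coordinate k does not
        change it.\<close>
      have "v(k := y) ` {..<k} = v ` {..<k}" by (intro image_cong) auto
      then show "indicator ?N (v(k := y)) \<le> (indicator (span (v ` {..<k})) y :: ennreal)"
        by (auto simp: indicator_def)
    qed
    also have "\<dots> = (\<integral>\<^sup>+v. 0 \<partial>PiM ?I (\<lambda>_. gauss_vec :: 'a measure))"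
    proof (intro nn_integral_cong)
      fix v :: "nat \<Rightarrow> 'a"
      have "dim (span (v ` {..<k})) \<le> card (v ` {..<k})" unfolding dim_span by (rule dim_le_card') simp
      also have "\<dots> \<le> k" using card_image_le[of "{..<k}" v] by simp
      finally have "emeasure gauss_vec (span (v ` {..<k})) = 0"
        using k m by (intro emeasure_gauss_vec_subspace) auto
      then show "(\<integral>\<^sup>+y. indicator (span (v ` {..<k})) y \<partial>gauss_vec) = 0"
        using closed_span[of "v ` {..<k}"] by simp
    qed
    finally have "emeasure (gauss_pow m) ?N = 0" by simp
    then show ?thesis using N by (intro AE_I[of _ _ ?N]) auto
  qed
  then have "AE v in gauss_pow m. \<forall>k\<in>{..<m}. (v k :: 'a) \<notin> span (v ` {..<k})"
    by (intro AE_finite_allI) auto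
  then show ?thesis by eventually_elim (simp add: dim_image_eq_iff)
qed

section \<open>Continuous densities of the projections\<close>

text \<open>Fourier inversion without the cutoff, keeping the factor (2 pi)^m of
  \<open>smooth_dens\<close>. \<open>Re\<close> gives a real-valued function; under integrability
  the integral is a limit of real numbers.\<close>

definition limit_dens :: "nat \<Rightarrow> 'a::euclidean_space measure \<Rightarrow> (nat \<Rightarrow> 'a) \<Rightarrow> 'a \<Rightarrow> real" where
  "limit_dens m \<mu> v p = Re (CLINT u|lebesgue_pow m. fourier \<mu> (lincomb m v u) * cis (- (lincomb m v u \<bullet> p)))"

lemma gcutoff_tendsto_1: "(\<lambda>k. gcutoff m (1 / real (Suc k)) u) \<longlonglongrightarrow> 1"
proof -
  have "(\<lambda>k. 1 / real (Suc k)) \<longlonglongrightarrow> 0" by (rule LIMSEQ_Suc[OF lim_1_over_n])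
  then have "(\<lambda>k. \<Prod>i<m. exp (- (1 / real (Suc k) * u i)\<^sup>2 / 2)) \<longlonglongrightarrow> (\<Prod>i<m. exp (- (0 * u i)\<^sup>2 / 2))"
    by (intro tendsto_intros) auto
  then show ?thesis by (simp add: gcutoff_def)
qed

context
  fixes \<mu> :: "'a::euclidean_space measure" and m :: nat and v :: "nat \<Rightarrow> 'a"
  assumes \<mu>: "finite_measure \<mu>" and s\<mu> [measurable_cong]: "sets \<mu> = sets borel"
    and fin: "(\<integral>\<^sup>+u. ennreal (cmod (fourier \<mu> (lincomb m v u))) \<partial>lebesgue_pow m) < \<infinity>"
begin

lemma integrable_fourier_lincomb: "integrable (lebesgue_pow m) (\<lambda>u. fourier \<mu> (lincomb m v u))"
proof -
  note [measurable] = measurable_fourier[OF \<mu> s\<mu>]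
  show ?thesis using fin by (intro integrableI_bounded) auto
qed

lemma smooth_dens_tendsto_limit: "(\<lambda>k. smooth_dens m (1 / real (Suc k)) \<mu> v p) \<longlonglongrightarrow> limit_dens m \<mu> v p"
proof -
  note [measurable] = measurable_fourier[OF \<mu> s\<mu>]
  let ?f = "\<lambda>u. fourier \<mu> (lincomb m v u) * cis (- (lincomb m v u \<bullet> p))"
  have "(\<lambda>k. CLINT u|lebesgue_pow m. complex_of_real (gcutoff m (1 / real (Suc k)) u) * ?f u) \<longlonglongrightarrow> (CLINT u|lebesgue_pow m. ?f u)"
  proof (rule integral_dominated_convergence[where w="\<lambda>u. cmod (fourier \<mu> (lincomb m v u))"])
    show "AE u in lebesgue_pow m. (\<lambda>k. complex_of_real (gcutoff m (1 / real (Suc k)) u) * ?f u) \<longlonglongrightarrow> ?f u"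
    proof (rule AE_I2)
      fix u
      show "(\<lambda>k. complex_of_real (gcutoff m (1 / real (Suc k)) u) * ?f u) \<longlonglongrightarrow> ?f u"
        using tendsto_mult[OF tendsto_of_real[OF gcutoff_tendsto_1[of m u]] tendsto_const[of "?f u"]] by simp
    qed
    show "AE u in lebesgue_pow m. norm (complex_of_real (gcutoff m (1 / real (Suc k)) u) * ?f u) \<le> cmod (fourier \<mu> (lincomb m v u))" for k
      by (intro AE_I2) (auto simp: norm_mult gcutoff_pos less_imp_le gcutoff_le_1 intro!: mult_left_le_one_le)
  qed (use integrable_fourier_lincomb in auto)
  from tendsto_Re[OF this]
  show ?thesis unfolding limit_dens_def
    by (simp only: smooth_dens_fourier[OF \<mu> s\<mu>, symmetric] Re_complex_of_real zero_less_divide_1_iff of_nat_0_less_iff zero_less_Suc)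
qed

lemma limit_dens_nonneg: "limit_dens m \<mu> v p \<ge> 0"
  by (rule LIMSEQ_le_const[OF smooth_dens_tendsto_limit]) (auto intro!: smooth_dens_nonneg simp del: of_nat_Suc)

text \<open>Only the factor \<open>cis\<close> depends on the point, so |\<mu>^| dominates along
  every convergent sequence of points.\<close>

lemma continuous_limit_dens: "continuous_on UNIV (limit_dens m \<mu> v)"
proof (rule continuous_at_imp_continuous_on, safe)
  fix p :: 'a
  note [measurable] = measurable_fourier[OF \<mu> s\<mu>]
  show "isCont (limit_dens m \<mu> v) p"
    unfolding continuous_at_sequentially comp_def
  proof safe
    fix x :: "nat \<Rightarrow> 'a" assume x: "x \<longlonglongrightarrow> p"
    have "(\<lambda>k. CLINT u|lebesgue_pow m. fourier \<mu> (lincomb m v u) * cis (- (lincomb m v u \<bullet> x k)))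
      \<longlonglongrightarrow> (CLINT u|lebesgue_pow m. fourier \<mu> (lincomb m v u) * cis (- (lincomb m v u \<bullet> p)))"
    proof (rule integral_dominated_convergence[where w="\<lambda>u. cmod (fourier \<mu> (lincomb m v u))"])
      have c: "isCont (\<lambda>q. fourier \<mu> (lincomb m v u) * cis (- (lincomb m v u \<bullet> q))) p" for u
      proof -
        have "continuous_on UNIV (\<lambda>q. fourier \<mu> (lincomb m v u) * cis (- (lincomb m v u \<bullet> q)))"
          by (intro continuous_intros)
        then show ?thesis by (simp add: continuous_on_eq_continuous_at)
      qed
      show "AE u in lebesgue_pow m. (\<lambda>k. fourier \<mu> (lincomb m v u) * cis (- (lincomb m v u \<bullet> x k))) \<longlonglongrightarrow> fourier \<mu> (lincomb m v u) * cis (- (lincomb m v u \<bullet> p))"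
        by (intro AE_I2 isCont_tendsto_compose[OF c x])
    qed (use integrable_fourier_lincomb in \<open>auto simp: norm_mult\<close>)
    then show "(\<lambda>k. limit_dens m \<mu> v (x k)) \<longlonglongrightarrow> limit_dens m \<mu> v p"
      unfolding limit_dens_def by (rule tendsto_Re)
  qed
qed

text \<open>If the fibre through p misses C, the smoothed densities at p tend to 0, and their limit
  is \<open>limit_dens\<close>.\<close>

lemma limit_dens_pos_imp_cylinder:
  assumes C: "compact C" "AE x in \<mu>. x \<in> C" and "limit_dens m \<mu> v p > 0"
  shows "p \<in> cylinder m v C"
proof (rule ccontr)
  assume "p \<notin> cylinder m v C"
  then have "(\<lambda>k. smooth_dens m (1 / real (Suc k)) \<mu> v p) \<longlonglongrightarrow> 0"
    by (intro smooth_dens_tendsto_0[OF \<mu> s\<mu> C]) (auto simp: cylinder_def)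
  then show False using LIMSEQ_unique[OF smooth_dens_tendsto_limit] assms(3) by simp
qed

text \<open>The majorant is the constant \<open>B\<close> from \<open>smooth_dens_le\<close>,
  integrable because \<nu> is finite.\<close>

lemma integral_smooth_dens_tendsto:
  assumes \<nu>: "finite_measure \<nu>" and [measurable_cong]: "sets \<nu> = sets borel"
  shows "(\<lambda>k. LINT x|\<nu>. smooth_dens m (1 / real (Suc k)) \<mu> v x) \<longlonglongrightarrow> (LINT x|\<nu>. limit_dens m \<mu> v x)"
proof -
  interpret finite_measure \<nu> by fact
  note [measurable] = measurable_smooth_dens[OF \<mu> s\<mu>] borel_measurable_continuous_onI[OF continuous_limit_dens]
  let ?F = "\<integral>\<^sup>+u. ennreal (cmod (fourier \<mu> (lincomb m v u))) \<partial>lebesgue_pow m"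
  obtain B where B: "?F = ennreal B" "B \<ge> 0" using fin by (cases ?F) auto
  show ?thesis
  proof (rule integral_dominated_convergence[where w="\<lambda>_. B"])
    show "AE x in \<nu>. norm (smooth_dens m (1 / real (Suc k)) \<mu> v x) \<le> B" for k
    proof (rule AE_I2)
      fix x
      have "ennreal (smooth_dens m (1 / real (Suc k)) \<mu> v x) \<le> ennreal B"
        unfolding B(1)[symmetric] by (rule smooth_dens_le[OF \<mu> s\<mu>]) simp
      then show "norm (smooth_dens m (1 / real (Suc k)) \<mu> v x) \<le> B"
        using B(2) by (simp add: smooth_dens_nonneg del: of_nat_Suc)
    qed
  qed (auto simp: smooth_dens_tendsto_limit simp del: of_nat_Suc)
qed

end

section \<open>Pairings of measures and positivity of the limit densities\<close>

lemma gkernel_le: "\<epsilon> > 0 \<Longrightarrow> gkernel \<epsilon> w \<le> sqrt (2 * pi) / \<epsilon>"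
  unfolding gkernel_def by (intro mult_left_le) auto

lemma gkernel_even: "gkernel \<epsilon> (a \<bullet> (x - y)) = gkernel \<epsilon> (a \<bullet> (y - x))"
  by (simp add: gkernel_def inner_diff_right power2_commute)

lemma gkernel_prod_bound: "\<epsilon> > 0 \<Longrightarrow> norm (\<Prod>i<m. gkernel \<epsilon> (w i)) \<le> (sqrt (2 * pi) / \<epsilon>) ^ m"
proof -
  assume e: "\<epsilon> > 0"
  have "(\<Prod>i<m. gkernel \<epsilon> (w i)) \<le> (\<Prod>i<m. sqrt (2 * pi) / \<epsilon>)"
    using e by (intro prod_mono) (auto simp: gkernel_nonneg gkernel_le)
  moreover have "(\<Prod>i<m. gkernel \<epsilon> (w i)) \<ge> 0" using e by (intro prod_nonneg) (auto simp: gkernel_nonneg)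
  ultimately show ?thesis by simp
qed

text \<open>Fubini's theorem and the evenness of the Gaussian turn the density of the difference at
  0 into a pairing of the smoothed density of \<nu> with \<mu>.\<close>

lemma smooth_dens_difference:
  fixes \<mu> \<nu> :: "'a::euclidean_space measure"
  assumes \<mu>: "finite_measure \<mu>" and \<nu>: "finite_measure \<nu>"
    and s: "sets \<mu> = sets borel" "sets \<nu> = sets borel" and e: "\<epsilon> > 0"
  shows "smooth_dens m \<epsilon> (difference_distr \<mu> \<nu>) v 0 = (LINT x|\<mu>. smooth_dens m \<epsilon> \<nu> v x)"
proof -
  have "smooth_dens m \<epsilon> (difference_distr \<mu> \<nu>) v 0 = (LINT x|\<mu>. LINT y|\<nu>. (\<Prod>i<m. gkernel \<epsilon> (v i \<bullet> (x - y))))"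
    unfolding smooth_dens_def
    by (simp, rule integral_difference_distr[OF \<mu> \<nu> s, where B="(sqrt (2 * pi) / \<epsilon>) ^ m"])
       (use gkernel_prod_bound[OF e] in auto)
  also have "\<dots> = (LINT x|\<mu>. smooth_dens m \<epsilon> \<nu> v x)"
    unfolding smooth_dens_def by (subst gkernel_even) simp
  finally show ?thesis .
qed

text \<open>The Fourier transform of a self-difference is \<open>|\<mu>^|\<^sup>2 \<ge> 0\<close>, so weakening the cutoff only adds mass.\<close>
lemma smooth_dens_self_difference_mono:
  fixes \<mu> :: "'a::euclidean_space measure"
  assumes \<mu>: "finite_measure \<mu>" and s: "sets \<mu> = sets borel" and e: "0 < \<epsilon>" "\<epsilon> \<le> \<delta>"
  shows "smooth_dens m \<delta> (difference_distr \<mu> \<mu>) v 0 \<le> smooth_dens m \<epsilon> (difference_distr \<mu> \<mu>) v 0"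
proof -
  let ?D = "difference_distr \<mu> \<mu>"
  have D: "finite_measure ?D" using \<mu> s by (intro finite_difference_distr)
  have eq: "fourier ?D \<xi> = of_real ((cmod (fourier \<mu> \<xi>))\<^sup>2)" for \<xi>
    unfolding fourier_difference_distr[OF \<mu> \<mu> s s] complex_norm_square ..
  have *: "complex_of_real (smooth_dens m \<gamma> ?D v 0) = of_real (LINT u|lebesgue_pow m. gcutoff m \<gamma> u * (cmod (fourier \<mu> (lincomb m v u)))\<^sup>2)" if "\<gamma> > 0" for \<gamma>
    using smooth_dens_fourier[OF D sets_difference_distr that, of m v 0]
    unfolding eq by (simp flip: of_real_mult of_real_power)
  have i: "integrable (lebesgue_pow m) (\<lambda>u. gcutoff m \<gamma> u * (cmod (fourier \<mu> (lincomb m v u)))\<^sup>2)" if "\<gamma> > 0" for \<gamma>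
    using integrable_Re[OF integrable_cutoff_fourier[OF D sets_difference_distr that, of m v 0]]
    unfolding eq by (simp flip: of_real_mult of_real_power)
  show ?thesis
    using * i e gcutoff_antimono[OF e] unfolding of_real_eq_iff
    by (auto intro!: integral_mono mult_right_mono)
qed

lemma smooth_dens_pos:
  fixes \<mu> :: "'a::euclidean_space measure"
  assumes \<mu>: "finite_measure \<mu>" and [measurable_cong]: "sets \<mu> = sets borel" and e: "\<epsilon> > 0"
    and "emeasure \<mu> (space \<mu>) \<noteq> 0"
  shows "smooth_dens m \<epsilon> \<mu> v p > 0"
proof -
  interpret finite_measure \<mu> by fact
  show ?thesis unfolding smooth_dens_def
  proof (rule integral_pos)
    show "integrable \<mu> (\<lambda>x. \<Prod>i<m. gkernel \<epsilon> (v i \<bullet> (x - p)))"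
      by (rule integrable_const_bound[where B="(sqrt (2 * pi) / \<epsilon>) ^ m"]) (use gkernel_prod_bound[OF e] in auto)
  qed (use assms in \<open>auto intro!: prod_pos gkernel_pos\<close>)
qed

text \<open>Pairing the restriction of \<open>\<mu>\<close> to \<open>B\<close> with itself gives a smoothed density that increases as
  \<open>\<epsilon>\<close> decreases, so the integral of the limit density over \<open>B\<close> cannot vanish.\<close>
lemma limit_dens_pos_on:
  fixes \<mu> :: "'a::euclidean_space measure"
  assumes \<mu>: "finite_measure \<mu>" and s [measurable_cong]: "sets \<mu> = sets borel"
    and fin: "(\<integral>\<^sup>+u. ennreal (cmod (fourier \<mu> (lincomb m v u))) \<partial>lebesgue_pow m) < \<infinity>"
    and B [measurable]: "B \<in> sets borel" and pos: "emeasure \<mu> B \<noteq> 0"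
  shows "\<exists>y\<in>B. limit_dens m \<mu> v y > 0"
proof (rule ccontr)
  assume "\<not> (\<exists>y\<in>B. limit_dens m \<mu> v y > 0)"
  then have z: "limit_dens m \<mu> v y = 0" if "y \<in> B" for y
    using limit_dens_nonneg[OF \<mu> s fin, of y] that by fastforce
  interpret finite_measure \<mu> by fact
  define \<nu> where "\<nu> = density \<mu> (indicator B)"
  have s\<nu> [measurable_cong]: "sets \<nu> = sets borel" by (simp add: \<nu>_def s)
  have em: "emeasure \<nu> (space \<nu>) = emeasure \<mu> B"
    using sets.sets_into_space[OF B] by (simp add: \<nu>_def emeasure_density nn_integral_indicator)
  have \<nu>: "finite_measure \<nu>" by (rule finite_measureI) (simp add: em emeasure_finite)
  have int: "(LINT x|\<nu>. f x) = (LINT x|\<mu>. indicator B x * f x)" if "f \<in> borel_measurable borel" for f :: "'a \<Rightarrow> real"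
    unfolding \<nu>_def ennreal_indicator[symmetric] by (subst integral_density) (use that in auto)
  note [measurable] = measurable_smooth_dens[OF \<mu> s] borel_measurable_continuous_onI[OF continuous_limit_dens[OF \<mu> s fin]]
  have "(LINT x|\<nu>. limit_dens m \<mu> v x) = 0"
    by (subst int) (auto simp: indicator_def z intro!: integral_eq_zero_AE AE_I2)
  then have lim: "(\<lambda>k. LINT x|\<nu>. smooth_dens m (1 / real (Suc k)) \<mu> v x) \<longlonglongrightarrow> 0"
    using integral_smooth_dens_tendsto[OF \<mu> s fin \<nu> s\<nu>] by simp
  let ?D = "difference_distr \<nu> \<nu>"
  let ?c = "smooth_dens m 1 ?D v 0"
  have "?c > 0"
    using pos em by (intro smooth_dens_pos finite_difference_distr \<nu> s\<nu>)
      (simp_all only: emeasure_difference_distr_space[OF \<nu> \<nu> s\<nu> s\<nu>], simp_all)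
  moreover have "?c \<le> (LINT x|\<nu>. smooth_dens m (1 / real (Suc k)) \<mu> v x)" for k
  proof -
    let ?e = "1 / real (Suc k)"
    interpret N: finite_measure \<nu> by fact
    have e: "?e > 0" "?e \<le> 1" by auto
    \<comment> \<open>The restricted measure \<nu> is at most \<mu>, and the kernels are
      nonnegative.\<close>
    have le: "smooth_dens m ?e \<nu> v x \<le> smooth_dens m ?e \<mu> v x" for x
    proof -
      have m1: "(\<lambda>y. \<Prod>i<m. gkernel ?e (v i \<bullet> (y - x))) \<in> borel_measurable borel" by measurable
      have "smooth_dens m ?e \<nu> v x = (LINT y|\<mu>. indicator B y * (\<Prod>i<m. gkernel ?e (v i \<bullet> (y - x))))"
        unfolding smooth_dens_def by (rule int[OF m1])
      also have "\<dots> \<le> smooth_dens m ?e \<mu> v x"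
        unfolding smooth_dens_def
      proof (rule integral_mono)
        have b: "norm (\<Prod>i<m. gkernel ?e (v i \<bullet> (y - x))) \<le> (sqrt (2 * pi) / ?e) ^ m" for y
          by (rule gkernel_prod_bound[OF e(1)])
        show i: "integrable \<mu> (\<lambda>y. \<Prod>i<m. gkernel ?e (v i \<bullet> (y - x)))"
          by (rule integrable_const_bound[where B="(sqrt (2 * pi) / ?e) ^ m"]) (use b in \<open>auto simp del: of_nat_Suc\<close>)
        show "integrable \<mu> (\<lambda>y. indicator B y * (\<Prod>i<m. gkernel ?e (v i \<bullet> (y - x))))"
          using integrable_mult_indicator[OF _ i, of B] by (simp add: s)
        show "indicator B y * (\<Prod>i<m. gkernel ?e (v i \<bullet> (y - x))) \<le> (\<Prod>i<m. gkernel ?e (v i \<bullet> (y - x)))" for y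
          using e(1) by (intro mult_left_le_one_le prod_nonneg) (auto simp: gkernel_nonneg simp del: of_nat_Suc)
      qed
      finally show ?thesis .
    qed
    have bnd: "integrable \<nu> (smooth_dens m ?e \<rho> v)" if \<rho>: "finite_measure \<rho>" "sets \<rho> = sets borel" for \<rho>
    proof (rule N.integrable_const_bound)
      interpret R: finite_measure \<rho> by fact
      show "AE x in \<nu>. norm (smooth_dens m ?e \<rho> v x) \<le> (sqrt (2 * pi) / ?e) ^ m * measure \<rho> (space \<rho>)"
      proof (rule AE_I2)
        fix x
        have "norm (smooth_dens m ?e \<rho> v x) \<le> (LINT y|\<rho>. norm (\<Prod>i<m. gkernel ?e (v i \<bullet> (y - x))))"
          unfolding smooth_dens_def by (rule integral_norm_bound)
        also have "\<dots> \<le> (LINT y|\<rho>. (sqrt (2 * pi) / ?e) ^ m)"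
          by (rule integral_mono') (use gkernel_prod_bound[OF e(1)] in \<open>auto simp del: of_nat_Suc\<close>)
        finally show "norm (smooth_dens m ?e \<rho> v x) \<le> (sqrt (2 * pi) / ?e) ^ m * measure \<rho> (space \<rho>)"
          by (simp add: mult.commute)
      qed
      show "smooth_dens m ?e \<rho> v \<in> borel_measurable \<nu>"
        using measurable_smooth_dens(2)[OF \<rho>] measurable_cong_sets[OF s\<nu> refl] by blast
    qed
    have "?c \<le> smooth_dens m ?e ?D v 0"
      by (rule smooth_dens_self_difference_mono[OF \<nu> s\<nu> e])
    also have "\<dots> = (LINT x|\<nu>. smooth_dens m ?e \<nu> v x)"
      by (rule smooth_dens_difference[OF \<nu> \<nu> s\<nu> s\<nu> e(1)])
    also have "\<dots> \<le> (LINT x|\<nu>. smooth_dens m ?e \<mu> v x)"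
      by (intro integral_mono bnd \<mu> \<nu> s s\<nu> le)
    finally show ?thesis .
  qed
  ultimately have "?c \<le> 0" using lim by (intro LIMSEQ_le_const[OF lim]) auto
  with \<open>?c > 0\<close> show False by simp
qed

text \<open>The sequence in \<open>nlim\<close> converges to the integral of the limit density of
  \<nu> against \<mu>, which is therefore nonzero. \<open>limit_dens_pos_on\<close> then finds a
  point where both limit densities are positive; by continuity they are so nearby, inside both
  cylinders.\<close>

lemma interior_cylinders_nonempty:
  fixes \<mu> \<nu> :: "'a::euclidean_space measure"
  assumes \<mu>: "finite_measure \<mu>" and \<nu>: "finite_measure \<nu>"
    and s\<mu> [measurable_cong]: "sets \<mu> = sets borel" and s\<nu> [measurable_cong]: "sets \<nu> = sets borel"
    and fin\<mu>: "(\<integral>\<^sup>+u. ennreal (cmod (fourier \<mu> (lincomb m v u))) \<partial>lebesgue_pow m) < \<infinity>"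
    and fin\<nu>: "(\<integral>\<^sup>+u. ennreal (cmod (fourier \<nu> (lincomb m v u))) \<partial>lebesgue_pow m) < \<infinity>"
    and K: "compact K" "AE x in \<mu>. x \<in> K" and L: "compact L" "AE x in \<nu>. x \<in> L"
    and nlim: "\<not> (\<lambda>k. smooth_dens m (1 / real (Suc k)) (difference_distr \<mu> \<nu>) v 0) \<longlonglongrightarrow> 0"
  shows "interior (cylinder m v K \<inter> cylinder m v L) \<noteq> {}"
proof -
  note c\<mu> = continuous_limit_dens[OF \<mu> s\<mu> fin\<mu>] and c\<nu> = continuous_limit_dens[OF \<nu> s\<nu> fin\<nu>]
  let ?U = "{y. limit_dens m \<mu> v y > 0}" and ?B = "{y. limit_dens m \<nu> v y > 0}"
  have oU: "open ?U" using c\<mu> by (intro open_Collect_less continuous_on_const)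
  have oB: "open ?B" using c\<nu> by (intro open_Collect_less continuous_on_const)
  have "emeasure \<mu> ?B \<noteq> 0"
  proof
    assume "emeasure \<mu> ?B = 0"
    then have "AE x in \<mu>. x \<notin> ?B" using oB s\<mu> by (intro AE_I[of _ _ ?B]) auto
    then have "AE x in \<mu>. limit_dens m \<nu> v x = 0"
      by eventually_elim (use limit_dens_nonneg[OF \<nu> s\<nu> fin\<nu>] in \<open>auto simp: order.antisym not_less\<close>)
    then have "(LINT x|\<mu>. limit_dens m \<nu> v x) = 0" by (rule integral_eq_zero_AE)
    then show False
      using integral_smooth_dens_tendsto[OF \<nu> s\<nu> fin\<nu> \<mu> s\<mu>] nlim
      by (simp add: smooth_dens_difference[OF \<mu> \<nu> s\<mu> s\<nu>] del: of_nat_Suc)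
  qed
  then obtain y where y: "y \<in> ?B" "y \<in> ?U"
    using limit_dens_pos_on[OF \<mu> s\<mu> fin\<mu>, of ?B] oB by auto
  have "?U \<inter> ?B \<subseteq> cylinder m v K \<inter> cylinder m v L"
    using limit_dens_pos_imp_cylinder[OF \<mu> s\<mu> fin\<mu> K] limit_dens_pos_imp_cylinder[OF \<nu> s\<nu> fin\<nu> L] by auto
  then have "y \<in> interior (cylinder m v K \<inter> cylinder m v L)"
    using y oU oB by (intro interiorI[of "?U \<inter> ?B"]) auto
  then show ?thesis by blast
qed

text \<open>The intersection of the cylinders is closed, so its interior can be tested on a
  countable dense set, where membership is measurable.\<close>

lemma pred_interior_cylinders:
  fixes K L :: "'a::euclidean_space set"
  assumes K: "compact K" and L: "compact L"
  shows "Measurable.pred (gauss_pow m) (\<lambda>v. interior (cylinder m v K \<inter> cylinder m v L) \<noteq> {})"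
proof -
  obtain D :: "'a set" where D: "countable D" "UNIV \<subseteq> closure D"
    by (rule separable[of UNIV])
  have "closed (cylinder m v K \<inter> cylinder m v L)" for v
    using closed_cylinder[OF K] closed_cylinder[OF L] by blast
  note * = interior_nonempty_iff_dense[OF this top.extremum_uniqueI[OF D(2)]]
  show ?thesis unfolding * Int_iff
    by (intro measurable_pred_countable[OF D(1)] pred_intros_countable pred_intros_imp' pred_intros_logic(3) pred_mem_cylinder K L)
qed

section \<open>Positive measure of the sets of subspaces\<close>

theorem theorem3p3:
  fixes \<mu> \<nu> :: "('a::euclidean_space) measure" and m :: nat and s t :: real
  assumes "1 \<le> m" and "m < DIM('a)"
    and "s > 0" and "t > 0" and "s + t \<ge> 2 * real m"
    and "sets \<mu> = sets borel" and "sets \<nu> = sets borel"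
    and "emeasure \<mu> (space \<mu>) < \<infinity>" and "emeasure \<nu> (space \<nu>) < \<infinity>"
    and "emeasure \<mu> (space \<mu>) \<noteq> 0" and "emeasure \<nu> (space \<nu>) \<noteq> 0"
    and "compact (spt \<mu>)" and "compact (spt \<nu>)"
    and "energy s \<mu> < \<infinity>" and "energy t \<nu> < \<infinity>"
  shows "gamma_grass m {V \<in> grass m. oproj V ` spt \<mu> \<inter> oproj V ` spt \<nu> \<noteq> {}} > 0
    \<and> (s > 2 * real m \<and> t > 2 * real m \<longrightarrow>
         gamma_grass m {V \<in> grass m.
            (top_of_set V) interior_of (oproj V ` spt \<mu> \<inter> oproj V ` spt \<nu>) \<noteq> {}} > 0)"
proof -
  let ?K = "spt \<mu>" and ?L = "spt \<nu>" and ?D = "difference_distr \<mu> \<nu>"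
  let ?G = "gauss_pow m :: (nat \<Rightarrow> 'a) measure"
  \<comment> \<open>The projections meet exactly when some vector of this set of differences is
    orthogonal to the subspace.\<close>
  define C where "C = {x - y | x y. x \<in> ?K \<and> y \<in> ?L}"
  interpret N: sigma_finite_measure "lebesgue_pow m" by (rule sigma_finite_lebesgue_pow)
  have \<mu>: "finite_measure \<mu>" and \<nu>: "finite_measure \<nu>"
    using assms(8,9) by (auto intro!: finite_measureI simp: less_top)
  note s\<mu> = assms(6) and s\<nu> = assms(7)
  note [measurable_cong] = s\<mu> s\<nu>
  note K = assms(12) AE_spt[OF s\<mu>] and L = assms(13) AE_spt[OF s\<nu>]
  have D: "finite_measure ?D" by (intro finite_difference_distr \<mu> \<nu> s\<mu> s\<nu>)
  have Dnz: "emeasure ?D (space ?D) \<noteq> 0"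
    unfolding emeasure_difference_distr_space[OF \<mu> \<nu> s\<mu> s\<nu>] using assms(10,11) by simp
  have C: "compact C" unfolding C_def using assms(12,13) by (rule compact_differences)
  have AEC: "AE z in ?D. z \<in> C"
    by (rule AE_difference_distr[OF \<mu> \<nu> s\<mu> s\<nu> K(2) L(2)]) (use C in \<open>auto simp: C_def borel_compact\<close>)
  have not_null: "\<not> (AE v in ?G. (\<lambda>k. smooth_dens m (1 / real (Suc k)) ?D v 0) \<longlonglongrightarrow> 0)"
    by (rule smooth_dens_not_null[OF D sets_difference_distr Dnz])
       (rule nn_integral_fourier_difference_finite[OF \<mu> \<nu> s\<mu> s\<nu> assms(1,3,4,5,14,15)])
  \<comment> \<open>Both conclusions follow one scheme: a measurable event off which the smoothed
    densities of \<open>?D\<close> tend to 0 almost surely cannot be null, by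
    \<open>not_null\<close>. Membership in \<open>grass m\<close> is measurable and has probability
    one.\<close>
  have pos: "emeasure ?G {v \<in> space ?G. span (v ` {..<m}) \<in> {V \<in> grass m. P V}} > 0"
    if iff: "\<And>v. P (span (v ` {..<m})) \<longleftrightarrow> Q v" and Q: "Measurable.pred ?G Q"
      and AE: "AE v in ?G. \<not> Q v \<longrightarrow> (\<lambda>k. smooth_dens m (1 / real (Suc k)) ?D v 0) \<longlonglongrightarrow> 0"
    for P Q
  proof -
    let ?A = "{v \<in> space ?G. span (v ` {..<m}) \<in> {V \<in> grass m. P V}}"
    have eq: "?A = {v \<in> space ?G. (\<forall>k\<in>{..<m}. v k \<notin> span (v ` {..<k})) \<and> Q v}"
      using dim_image_eq_iff[of _ m] iff by (auto simp: grass_def)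
    have p: "Measurable.pred ?G (\<lambda>v. \<forall>k\<in>{..<m}. v k \<notin> span (v ` {..<k}))"
      by (intro pred_intros_finite pred_not_mem_span) auto
    have A: "?A \<in> sets ?G"
      unfolding eq using pred_intros_logic(3)[OF p Q] by (simp only: pred_def)
    have "emeasure ?G ?A \<noteq> 0"
    proof
      assume "emeasure ?G ?A = 0"
      then have "AE v in ?G. v \<notin> ?A" using A by (intro AE_I[of _ _ ?A]) auto
      then have "AE v in ?G. (\<lambda>k. smooth_dens m (1 / real (Suc k)) ?D v 0) \<longlonglongrightarrow> 0"
        using AE AE_dim_gauss_pow[OF assms(2)] AE_space
        by eventually_elim (auto simp: grass_def iff dim_image_eq_iff)
      then show False using not_null by blast
    qed
    then show ?thesis by (simp add: zero_less_iff_neq_zero)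
  qed
  show ?thesis
    unfolding gamma_grass_def
  proof (intro conjI impI)
    show "emeasure ?G {v \<in> space ?G. span (v ` {..<m}) \<in> {V \<in> grass m. oproj V ` ?K \<inter> oproj V ` ?L \<noteq> {}}} > 0"
    proof (rule pos[where Q="\<lambda>v. \<exists>z\<in>C. \<forall>i<m. v i \<bullet> z = 0"])
      fix v :: "nat \<Rightarrow> 'a"
      let ?V = "span (v ` {..<m})"
      have "oproj ?V ` ?K \<inter> oproj ?V ` ?L \<noteq> {} \<longleftrightarrow> (\<exists>x\<in>?K. \<exists>y\<in>?L. oproj ?V x = oproj ?V y)"
        by blast
      then show "oproj ?V ` ?K \<inter> oproj ?V ` ?L \<noteq> {} \<longleftrightarrow> (\<exists>z\<in>C. \<forall>i<m. v i \<bullet> z = 0)"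
        unfolding oproj_eq_iff C_def by blast
    next
      show "AE v in ?G. \<not> (\<exists>z\<in>C. \<forall>i<m. v i \<bullet> z = 0) \<longrightarrow> (\<lambda>k. smooth_dens m (1 / real (Suc k)) ?D v 0) \<longlonglongrightarrow> 0"
        by (intro AE_I2 impI smooth_dens_tendsto_0[OF D sets_difference_distr C AEC]) auto
    qed (rule pred_hits_compact[OF C])
  next
    assume st: "s > 2 * real m \<and> t > 2 * real m"
    note [measurable] = measurable_fourier[OF \<mu> s\<mu>] measurable_fourier[OF \<nu> s\<nu>]
    \<comment> \<open>Finite expectations make both transforms integrable over \<open>u\<close> for
      almost every \<open>v\<close>, so both limit densities are continuous there.\<close>
    have "AE v in ?G. (\<integral>\<^sup>+u. ennreal (cmod (fourier \<mu> (lincomb m v u))) \<partial>lebesgue_pow m) \<noteq> \<infinity>"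
      by (rule nn_integral_PInf_AE) (use nn_integral_fourier_finite[OF \<mu> s\<mu> assms(1) _ assms(14)] st in auto)
    moreover have "AE v in ?G. (\<integral>\<^sup>+u. ennreal (cmod (fourier \<nu> (lincomb m v u))) \<partial>lebesgue_pow m) \<noteq> \<infinity>"
      by (rule nn_integral_PInf_AE) (use nn_integral_fourier_finite[OF \<nu> s\<nu> assms(1) _ assms(15)] st in auto)
    ultimately have AE: "AE v in ?G. \<not> interior (cylinder m v ?K \<inter> cylinder m v ?L) \<noteq> {} \<longrightarrow> (\<lambda>k. smooth_dens m (1 / real (Suc k)) ?D v 0) \<longlonglongrightarrow> 0"
    proof eventually_elim
      case (elim v)
      then show ?case
        using interior_cylinders_nonempty[OF \<mu> \<nu> s\<mu> s\<nu> _ _ K L, of m v] by (auto simp: less_top)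
    qed
    show "emeasure ?G {v \<in> space ?G. span (v ` {..<m}) \<in> {V \<in> grass m. (top_of_set V) interior_of (oproj V ` ?K \<inter> oproj V ` ?L) \<noteq> {}}} > 0"
    proof (rule pos[where Q="\<lambda>v. interior (cylinder m v ?K \<inter> cylinder m v ?L) \<noteq> {}", OF _ _ AE])
      fix v :: "nat \<Rightarrow> 'a"
      let ?V = "span (v ` {..<m})"
      have "oproj ?V ` ?K \<inter> oproj ?V ` ?L \<subseteq> ?V" using oproj_in[OF subspace_span] by blast
      note interior_of_subspace_iff[OF subspace_span this]
      moreover have "oproj ?V -` (oproj ?V ` ?K \<inter> oproj ?V ` ?L) = cylinder m v ?K \<inter> cylinder m v ?L"
        by (intro set_eqI) (simp only: vimage_eq Int_iff oproj_mem_iff)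
      ultimately show "(top_of_set ?V) interior_of (oproj ?V ` ?K \<inter> oproj ?V ` ?L) \<noteq> {} \<longleftrightarrow> interior (cylinder m v ?K \<inter> cylinder m v ?L) \<noteq> {}"
        by (simp only:)
    qed (rule pred_interior_cylinders[OF assms(12,13)])
  qed
qed

end
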